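(* For any $\delta>\sqrt{\frac{16\log^2 n}{T}}$, there exists a streaming algorithm (not given the cost of the best expert) that achieves regret at most $\delta$ in expectation on random-order streams, using $O\!\left(\frac{n}{\delta^2 T}\log^2 n\right)$ space.
   Context: Online learning with experts in the streaming model: $n$ experts, $T$ days; on each day the algorithm sees the experts' predictions, follows one of them (incurring that expert's cost), then sees the costs $c_i^{(t)}\in[0,1]$ of all experts. Regret is (total cost of the algorithm minus $\min_i\sum_t c_i^{(t)}$)$/T$. (If costs lie in $[0,\rho]$ instead, the regret bound scales to $\rho\delta$.) Random-order streams: the days (each day's predictions and costs together) arrive in a uniformly random order. Space is measured in words of $O(\log(nT))$ bits.
   Formalization: The space bound is read as O(max(1, n log²n/(δ²T))) words, since with n and δ fixed and T large the stated expression tends to 0 and an algorithm with no memory cannot achieve small regret. *)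

theory Defs
  imports "HOL-Probability.Probability" "HOL-Combinatorics.Permutations"
begin

text \<open>
  The memory of a streaming algorithm is an array of words. An algorithm for the experts problem
  is given by its (randomised) initialisation and transition kernels. The input arrives item by
  item: on each day the predictions are read one after the other, then an expert is followed, and
  then the costs are read one after the other. Whatever is to be remembered between two items
  (including the position in the stream) has to be held in the memory. Fresh random bits are free,
  but have to be stored if they are to be reused later.
\<close>

type_synonym memory = "nat list"

record 'p expert_algorithm =
  initial :: "memory pmf"
  read_prediction :: "memory \<Rightarrow> 'p \<Rightarrow> memory pmf"
  follow :: "memory \<Rightarrow> (memory \<times> nat) pmf"
  read_cost :: "memory \<Rightarrow> real \<Rightarrow> memory pmf"

definition memories :: "nat \<Rightarrow> nat \<Rightarrow> memory set" where
  "memories s b = {m. length m = s \<and> (\<forall>w\<in>set m. w < 2 ^ b)}"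

text \<open>
  The algorithm \<open>A\<close> for \<open>n\<close> experts runs in \<open>s\<close> words of \<open>b\<close> bits each: on every input and for all
  outcomes of its coins, its memory never leaves \<^term>\<open>memories s b\<close>. Experts are numbered
  \<open>0, \<dots>, n - 1\<close>.
\<close>

definition streaming_algorithm :: "'p expert_algorithm \<Rightarrow> nat \<Rightarrow> nat \<Rightarrow> nat \<Rightarrow> bool" where
  "streaming_algorithm A n s b \<longleftrightarrow>
     set_pmf (initial A) \<subseteq> memories s b \<and>
     (\<forall>m\<in>memories s b.
        (\<forall>p. set_pmf (read_prediction A m p) \<subseteq> memories s b) \<and>
        set_pmf (follow A m) \<subseteq> memories s b \<times> {..<n} \<and>
        (\<forall>r. set_pmf (read_cost A m r) \<subseteq> memories s b))"

primrec read_items :: "(memory \<Rightarrow> 'i \<Rightarrow> memory pmf) \<Rightarrow> 'i list \<Rightarrow> memory \<Rightarrow> memory pmf" where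
  "read_items f [] m = return_pmf m"
| "read_items f (y # ys) m = bind_pmf (f m y) (read_items f ys)"

text \<open>
  A day consists of the predictions and the costs of all experts. The result of processing it is
  the joint distribution of the new memory and of the cost incurred.
\<close>

type_synonym 'p day = "(nat \<Rightarrow> 'p) \<times> (nat \<Rightarrow> real)"

definition process_day ::
    "'p expert_algorithm \<Rightarrow> nat \<Rightarrow> 'p day \<Rightarrow> memory \<Rightarrow> (memory \<times> real) pmf" where
  "process_day A n d m =
     bind_pmf (read_items (read_prediction A) (map (fst d) [0..<n]) m) (\<lambda>m1.
     bind_pmf (follow A m1) (\<lambda>(m2, i).
     bind_pmf (read_items (read_cost A) (map (snd d) [0..<n]) m2) (\<lambda>m3.
     return_pmf (m3, snd d i))))"

primrec process_days :: "'p expert_algorithm \<Rightarrow> nat \<Rightarrow> 'p day list \<Rightarrow> memory \<Rightarrow> real pmf" where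
  "process_days A n [] m = return_pmf 0"
| "process_days A n (d # ds) m =
     bind_pmf (process_day A n d m) (\<lambda>(m', a).
     map_pmf (\<lambda>r. a + r) (process_days A n ds m'))"

definition total_cost :: "'p expert_algorithm \<Rightarrow> nat \<Rightarrow> 'p day list \<Rightarrow> real pmf" where
  "total_cost A n ds = bind_pmf (initial A) (process_days A n ds)"

definition best_expert_cost :: "nat \<Rightarrow> 'p day list \<Rightarrow> real" where
  "best_expert_cost n ds = Min ((\<lambda>i. \<Sum>d\<leftarrow>ds. snd d i) ` {..<n})"

definition regret :: "'p expert_algorithm \<Rightarrow> nat \<Rightarrow> 'p day list \<Rightarrow> real pmf" where
  "regret A n ds =
     map_pmf (\<lambda>a. (a - best_expert_cost n ds) / real (length ds)) (total_cost A n ds)"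

definition random_order :: "nat \<Rightarrow> (nat \<Rightarrow> 'p day) \<Rightarrow> 'p day list pmf" where
  "random_order T X =
     map_pmf (\<lambda>\<pi>. map (\<lambda>t. X (\<pi> t)) [0..<T]) (pmf_of_set {\<pi>. \<pi> permutes {..<T}})"

definition expected_regret_random_order ::
    "'p expert_algorithm \<Rightarrow> nat \<Rightarrow> nat \<Rightarrow> (nat \<Rightarrow> 'p day) \<Rightarrow> real" where
  "expected_regret_random_order A n T X =
     measure_pmf.expectation (bind_pmf (random_order T X) (regret A n)) (\<lambda>r. r)"

end

theory Submission
  imports Defs
begin

text \<open>
  Counters hold costs rounded down to multiples of \<open>1 / T\<close>, which costs at most \<open>1\<close> over the whole stream.

  If \<open>\<delta>\<^sup>2 T\<close> is at most a constant times \<open>ln\<^sup>2 n\<close>, the space bound allows one counter per expert, and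
  exponential weights (Hedge) have total regret about \<open>sqrt (2 T ln n)\<close> on every input.

  Otherwise the experts are split into \<open>P \<approx> \<delta>\<^sup>2 T / (5000 ln\<^sup>2 n)\<close> pools, whose counters share the memory. In
  phase \<open>j\<close> each pool in turn is tested on a block of \<open>2 ^ j\<close> days, while the algorithm follows the expert
  that had the best test in phase \<open>j - 1\<close>. In random order a block is a sample without replacement, so the
  deviation of its cost sum from the mean is subgaussian, and the expected maximum over all experts is
  \<open>O(sqrt (2 ^ j ln n))\<close>. No independence is needed, neither between the blocks of different experts nor
  between the choice of the expert and the days on which it is followed, as these maxima bound the
  regret pathwise. Phase \<open>j\<close> contributes \<open>O(P sqrt (2 ^ j ln n))\<close> to the regret, a geometric sum dominated by
  the last phase, where \<open>P 2 ^ j \<approx> T\<close>; the total is \<open>O(sqrt (P T ln n)) \<le> \<delta> T\<close>.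
\<close>

section \<open>Algorithms with deterministic memory updates\<close>

lemma expectation_bind_pmf:
  fixes h :: "'b \<Rightarrow> real"
  assumes "finite (set_pmf p)" "\<And>x. x \<in> set_pmf p \<Longrightarrow> finite (set_pmf (f x))"
  shows "measure_pmf.expectation (bind_pmf p f) h =
    measure_pmf.expectation p (\<lambda>x. measure_pmf.expectation (f x) h)"
  using assms by (simp add: pmf_expectation_bind integral_measure_pmf_real[of "set_pmf p"] mult.commute)

text \<open>Coins are tossed only to choose the expert, and the choice is not recorded, so the
  memory is a function of the costs seen so far.\<close>

definition table_algorithm ::
    "memory \<Rightarrow> (memory \<Rightarrow> real \<Rightarrow> memory) \<Rightarrow> (memory \<Rightarrow> nat pmf) \<Rightarrow> 'p expert_algorithm" where
  "table_algorithm m0 step pick =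
     \<lparr>initial = return_pmf m0, read_prediction = (\<lambda>m p. return_pmf m),
      follow = (\<lambda>m. map_pmf (Pair m) (pick m)), read_cost = (\<lambda>m r. return_pmf (step m r))\<rparr>"

lemma streaming_table_algorithm:
  assumes "m0 \<in> memories s b" "\<And>m r. m \<in> memories s b \<Longrightarrow> step m r \<in> memories s b"
    and "\<And>m. m \<in> memories s b \<Longrightarrow> set_pmf (pick m) \<subseteq> {..<n}"
  shows "streaming_algorithm (table_algorithm m0 step pick) n s b"
  using assms by (fastforce simp: streaming_algorithm_def table_algorithm_def)

definition table_after :: "(memory \<Rightarrow> real \<Rightarrow> memory) \<Rightarrow> memory \<Rightarrow> nat \<Rightarrow> (nat \<Rightarrow> nat \<Rightarrow> real) \<Rightarrow> nat \<Rightarrow> memory"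
  where "table_after step m0 n c t = foldl (\<lambda>m t. foldl step m (map (c t) [0..<n])) m0 [0..<t]"

lemma table_after_0 [simp]: "table_after step m0 n c 0 = m0"
  by (simp add: table_after_def)

lemma table_after_Suc:
  "table_after step m0 n c (Suc t) = foldl step (table_after step m0 n c t) (map (c t) [0..<n])"
  by (simp add: table_after_def)

text \<open>\<open>process_days\<close> consumes the stream from the front while
  \<open>table_after\<close> grows at the back; this bridges the two in the induction below.\<close>

lemma table_after_shift:
  "table_after step (foldl step m0 (map (c 0) [0..<n])) n (\<lambda>t. c (Suc t)) t = table_after step m0 n c (Suc t)"
  by (induction t) (simp_all add: table_after_Suc)

lemma read_items_return_pmf:
  "read_items (\<lambda>m y. return_pmf (g m y)) ys m = return_pmf (foldl g m ys)"
  by (induction ys arbitrary: m) (simp_all add: bind_return_pmf)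

lemma foldl_const: "foldl (\<lambda>m p. m) m ps = m"
  by (induction ps) auto

lemma process_day_table_algorithm:
  "process_day (table_algorithm m0 step pick) n d m =
     map_pmf (\<lambda>i. (foldl step m (map (snd d) [0..<n]), snd d i)) (pick m)"
  by (simp add: process_day_def table_algorithm_def read_items_return_pmf bind_return_pmf
      map_pmf_def bind_assoc_pmf foldl_const)

text \<open>As the memory does not depend on the experts picked, linearity of expectation gives one
  summand per day. Finite support is carried along to have integrability.\<close>

lemma process_days_table_algorithm:
  assumes fin: "\<And>m. finite (set_pmf (pick m))"
  shows "finite (set_pmf (process_days (table_algorithm m0 step pick) n ds m)) \<and>
    measure_pmf.expectation (process_days (table_algorithm m0 step pick) n ds m) (\<lambda>r. r) =
    (\<Sum>t<length ds. measure_pmf.expectation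
       (pick (table_after step m n (\<lambda>t. snd (ds ! t)) t)) (snd (ds ! t)))"
proof (induction ds arbitrary: m)
  case (Cons d ds)
  define m' where "m' = foldl step m (map (snd d) [0..<n])"
  let ?P = "process_days (table_algorithm m0 step pick) n"
  have eq: "?P (d # ds) m = bind_pmf (pick m) (\<lambda>i. map_pmf (\<lambda>r. snd d i + r) (?P ds m'))"
    by (simp add: process_day_table_algorithm map_pmf_def bind_assoc_pmf bind_return_pmf m'_def)
  have fin': "finite (set_pmf (?P ds m'))" using Cons.IH by blast
  have "measure_pmf.expectation (?P (d # ds) m) (\<lambda>r. r) =
      measure_pmf.expectation (pick m) (\<lambda>i. snd d i + measure_pmf.expectation (?P ds m') (\<lambda>r. r))"
    unfolding eq using fin fin'
    by (subst expectation_bind_pmf)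
      (auto simp: integrable_measure_pmf_finite intro!: Bochner_Integration.integral_cong)
  also have "\<dots> = measure_pmf.expectation (pick m) (snd d) + measure_pmf.expectation (?P ds m') (\<lambda>r. r)"
    using fin by (simp add: integrable_measure_pmf_finite)
  also have "\<dots> = (\<Sum>t<length (d # ds). measure_pmf.expectation
      (pick (table_after step m n (\<lambda>t. snd ((d # ds) ! t)) t)) (snd ((d # ds) ! t)))"
    using Cons.IH[of m'] table_after_shift[of step m "\<lambda>t. snd ((d # ds) ! t)" n]
    by (simp add: sum.lessThan_Suc_shift m'_def del: sum.lessThan_Suc)
  finally show ?case
    using fin fin' eq by simp
qed simp

text \<open>Lists can be peeled from the front and rotated, which is what the lemmas on sampling
  without replacement rely on.\<close>

lemma random_order_conv_permutations_of_set:
  "random_order T X = map_pmf (map X) (pmf_of_set (permutations_of_set {..<T}))"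
proof -
  have "bij_betw (\<lambda>\<pi>. map \<pi> [0..<T]) {\<pi>. \<pi> permutes {..<T}} (permutations_of_set {..<T})"
    unfolding bij_betw_def
  proof
    show "inj_on (\<lambda>\<pi>. map \<pi> [0..<T]) {\<pi>. \<pi> permutes {..<T}}"
    proof (intro inj_onI ext, clarsimp)
      fix f g x assume "f permutes {..<T}" "g permutes {..<T}" "\<forall>x\<in>{0..<T}. f x = g x"
      then show "f x = g x" by (cases "x < T") (auto simp: permutes_def)
    qed
    \<comment> \<open>Injectivity and equal cardinalities yield surjectivity.\<close>
    then have "card ((\<lambda>\<pi>. map \<pi> [0..<T]) ` {\<pi>. \<pi> permutes {..<T}}) = card (permutations_of_set {..<T})"
      by (simp add: card_image card_permutations)
    moreover have "(\<lambda>\<pi>. map \<pi> [0..<T]) ` {\<pi>. \<pi> permutes {..<T}} \<subseteq> permutations_of_set {..<T}"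
      by (auto simp: permutes_in_image permutes_inj_on distinct_map permutes_image atLeast0LessThan
          intro!: permutations_of_setI)
    ultimately show "(\<lambda>\<pi>. map \<pi> [0..<T]) ` {\<pi>. \<pi> permutes {..<T}} = permutations_of_set {..<T}"
      by (intro card_subset_eq) auto
  qed
  moreover have "{\<pi>. \<pi> permutes {..<T}} \<noteq> {}"
    using permutes_id by blast
  ultimately have "pmf_of_set (permutations_of_set {..<T}) =
      map_pmf (\<lambda>\<pi>. map \<pi> [0..<T]) (pmf_of_set {\<pi>. \<pi> permutes {..<T}})"
    by (simp add: map_pmf_of_set_bij_betw finite_permutations)
  then show ?thesis
    by (simp add: random_order_def pmf.map_comp o_def)
qed

lemma best_expert_cost_permutation:
  assumes "xs \<in> permutations_of_set {..<T}"
  shows "best_expert_cost n (map (\<lambda>t. (x t, c t)) xs) = Min ((\<lambda>i. \<Sum>t<T. c t i) ` {..<n})"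
proof -
  have "(\<Sum>t\<leftarrow>xs. c t i) = (\<Sum>t<T. c t i)" for i
    using assms by (metis permutations_of_setD sum.distinct_set_conv_list)
  then show ?thesis by (simp add: best_expert_cost_def o_def)
qed

text \<open>The cost of the best expert is invariant under reordering, so only the cost of the
  algorithm has to be averaged. All regret bounds below go through this formula.\<close>

lemma expected_regret_table_algorithm:
  assumes fin: "\<And>m. finite (set_pmf (pick m))"
  shows "expected_regret_random_order (table_algorithm m0 step pick) n T (\<lambda>t. (x t, c t)) =
    (measure_pmf.expectation (pmf_of_set (permutations_of_set {..<T}))
      (\<lambda>xs. \<Sum>t<T. measure_pmf.expectation (pick (table_after step m0 n (\<lambda>t. c (xs ! t)) t)) (c (xs ! t)))
     - Min ((\<lambda>i. \<Sum>t<T. c t i) ` {..<n})) / real T"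
proof -
  let ?X = "\<lambda>t. (x t, c t)" and ?A = "table_algorithm m0 step pick"
  let ?p = "pmf_of_set (permutations_of_set {..<T})"
  define B where "B = Min ((\<lambda>i. \<Sum>t<T. c t i) ` {..<n})"
  let ?f = "\<lambda>xs. \<Sum>t<T. measure_pmf.expectation (pick (table_after step m0 n (\<lambda>t. c (xs ! t)) t)) (c (xs ! t))"
  have set: "set_pmf ?p = permutations_of_set {..<T}" by simp
  have E: "finite (set_pmf (regret ?A n (map ?X xs))) \<and>
      measure_pmf.expectation (regret ?A n (map ?X xs)) (\<lambda>r. r) = (?f xs - B) / real T"
    if xs: "xs \<in> permutations_of_set {..<T}" for xs
  proof -
    have len: "length xs = T" using xs by (simp add: length_finite_permutations_of_set)
    have tot: "total_cost ?A n (map ?X xs) = process_days ?A n (map ?X xs) m0"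
      by (simp add: total_cost_def table_algorithm_def bind_return_pmf)
    have aft: "table_after step m0 n (\<lambda>t. snd (map ?X xs ! t)) t = table_after step m0 n (\<lambda>t. c (xs ! t)) t"
      if "t \<le> T" for t
      using that len by (induction t) (simp_all add: table_after_Suc)
    have P: "finite (set_pmf (process_days ?A n (map ?X xs) m0))"
      "measure_pmf.expectation (process_days ?A n (map ?X xs) m0) (\<lambda>r. r) = ?f xs"
      using process_days_table_algorithm[OF fin, where ds = "map ?X xs" and m = m0] aft len
      by auto
    show ?thesis
      using P by (simp add: regret_def tot len best_expert_cost_permutation[OF xs] B_def[symmetric]
          integrable_measure_pmf_finite)
  qed
  have "expected_regret_random_order ?A n T ?X =
      measure_pmf.expectation ?p (\<lambda>xs. measure_pmf.expectation (regret ?A n (map ?X xs)) (\<lambda>r. r))"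
    unfolding expected_regret_random_order_def random_order_conv_permutations_of_set bind_map_pmf
    by (rule expectation_bind_pmf) (use E set in auto)
  also have "\<dots> = measure_pmf.expectation ?p (\<lambda>xs. (?f xs - B) / real T)"
    by (rule integral_cong_AE) (use E set in \<open>auto simp: AE_measure_pmf_iff\<close>)
  also have "\<dots> = (measure_pmf.expectation ?p ?f - B) / real T"
    using set by (simp add: integrable_measure_pmf_finite)
  finally show ?thesis by (simp add: B_def)
qed

section \<open>Sampling without replacement\<close>

text \<open>Hoeffding's lemma for one uniform draw, with \<open>l\<close> of either sign.\<close>

lemma exp_moment_uniform_le:
  fixes f :: "'a \<Rightarrow> real"
  assumes A: "finite A" "A \<noteq> {}" and f: "\<And>x. x \<in> A \<Longrightarrow> f x \<in> {0..1}"
  defines "\<mu> \<equiv> (\<Sum>x\<in>A. f x) / card A"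
  shows "measure_pmf.expectation (pmf_of_set A) (\<lambda>x. exp (l * (f x - \<mu>))) \<le> exp (l\<^sup>2 / 8)"
proof -
  let ?p = "pmf_of_set A"
  \<comment> \<open>Hoeffding's lemma is stated for positive \<open>l\<close>. The free endpoint
    \<open>a\<close> allows applying it to \<open>- f\<close> with \<open>a = -1\<close>, which
    settles negative \<open>l\<close>.\<close>
  have pos: "measure_pmf.expectation ?p (\<lambda>x. exp (l * (g x - (\<Sum>x\<in>A. g x) / card A))) \<le> exp (l\<^sup>2 / 8)"
    if l: "l > 0" and g: "\<And>x. x \<in> A \<Longrightarrow> g x \<in> {a..a+1}" for g :: "'a \<Rightarrow> real" and a l
  proof -
    interpret interval_bounded_random_variable "measure_pmf ?p" g a "a + 1"
      by unfold_locales (use A g in \<open>auto simp: AE_measure_pmf_iff\<close>)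
    have mean: "measure_pmf.expectation ?p g = (\<Sum>x\<in>A. g x) / card A"
      using A by (simp add: integral_pmf_of_set)
    have "ennreal (measure_pmf.expectation ?p (\<lambda>x. exp (l * (g x - (\<Sum>x\<in>A. g x) / card A)))) =
        nn_integral (measure_pmf ?p) (\<lambda>x. exp (l * (g x - (\<Sum>x\<in>A. g x) / card A)))"
      by (intro nn_integral_eq_integral[symmetric] integrable_measure_pmf_finite) (use A in auto)
    also have "\<dots> \<le> ennreal (exp (l\<^sup>2 / 8))"
      using Hoeffdings_lemma_nn_integral[OF l] by (simp add: mean)
    finally show ?thesis by simp
  qed
  consider "l > 0" | "l = 0" | "l < 0" by linarith
  then show ?thesis
  proof cases
    case 3
    have "l * (f x - \<mu>) = (- l) * (- f x - (\<Sum>x\<in>A. - f x) / card A)" for x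
      by (simp add: \<mu>_def sum_negf algebra_simps)
    with pos[of "-l" "\<lambda>x. - f x" "-1"] 3 f show ?thesis by simp
  qed (use pos[of l f 0] f in \<open>auto simp: \<mu>_def\<close>)
qed

text \<open>
  Exposing the first element \<open>x\<close> of the permutation shifts the mean of the others by
  \<open>(\<mu> - f x) / (N - 1)\<close>, so its total effect on the deviation is \<open>1 - L / (N - 1)\<close> times \<open>f x - \<mu>\<close>.
\<close>

lemma exp_moment_permutation_prefix_le:
  fixes f :: "'a \<Rightarrow> real"
  assumes "finite A" "L \<le> card A" "\<And>x. x \<in> A \<Longrightarrow> f x \<in> {0..1}"
  shows "measure_pmf.expectation (pmf_of_set (permutations_of_set A))
    (\<lambda>xs. exp (l * ((\<Sum>t<L. f (xs ! t)) - L * ((\<Sum>x\<in>A. f x) / card A)))) \<le> exp (l\<^sup>2 * L / 8)"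
  using assms
proof (induction L arbitrary: A)
  case (Suc L)
  let ?\<mu> = "\<lambda>A. (\<Sum>x\<in>A. f x) / real (card A)"
  \<comment> \<open>The net weight of the first draw. If \<open>card A = 1\<close>, then
    \<open>L = 0\<close> and division by zero gives \<open>\<theta> = 1\<close>, the correct
    value.\<close>
  define \<theta> where "\<theta> = 1 - real L / (real (card A) - 1)"
  have A: "finite A" "A \<noteq> {}" using Suc.prems by auto
  have \<theta>: "0 \<le> \<theta>" "\<theta> \<le> 1" using Suc.prems(2) by (auto simp: \<theta>_def divide_le_eq)
  have dev: "f x + S - Suc L * ?\<mu> A = \<theta> * (f x - ?\<mu> A) + (S - L * ?\<mu> (A - {x}))" if "x \<in> A" for x S
  proof (cases "card A = 1")
    case True
    then show ?thesis using Suc.prems(2) by (simp add: \<theta>_def)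
  next
    case False
    with A have N: "card A \<ge> 2" using card_0_eq[of A] by linarith
    define N where "N = real (card A) - 1"
    have "N > 0" using N by (simp add: N_def)
    define \<mu> where "\<mu> = ?\<mu> A"
    have "(\<Sum>x\<in>A. f x) = (N + 1) * \<mu>"
      using N by (simp add: \<mu>_def N_def)
    then have "(\<Sum>x\<in>A - {x}. f x) = (N + 1) * \<mu> - f x"
      using A that by (simp add: sum_diff1)
    moreover have "real (card (A - {x})) = N"
      using A that N by (simp add: N_def of_nat_diff)
    ultimately have mean: "?\<mu> (A - {x}) = ((N + 1) * \<mu> - f x) / N"
      by simp
    have "f x + S - Suc L * \<mu> = (1 - L / N) * (f x - \<mu>) + (S - L * (((N + 1) * \<mu> - f x) / N))"
      using \<open>N > 0\<close> by (simp add: field_simps)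
    then show ?thesis
      by (simp only: mean \<theta>_def N_def \<mu>_def)
  qed
  \<comment> \<open>Condition on the first element \<open>x\<close>: the rest is a uniform
    permutation of \<open>A - {x}\<close>.\<close>
  have "measure_pmf.expectation (pmf_of_set (permutations_of_set A))
      (\<lambda>xs. exp (l * ((\<Sum>t<Suc L. f (xs ! t)) - Suc L * ?\<mu> A))) =
    measure_pmf.expectation (pmf_of_set A) (\<lambda>x. measure_pmf.expectation (pmf_of_set (permutations_of_set (A - {x})))
      (\<lambda>ys. exp (l * (f x + (\<Sum>t<L. f (ys ! t)) - Suc L * ?\<mu> A))))"
    using A by (subst random_permutation_of_set, simp, simp, subst expectation_bind_pmf)
      (simp_all add: sum.lessThan_Suc_shift del: sum.lessThan_Suc flip: map_pmf_def)
  also have "\<dots> = measure_pmf.expectation (pmf_of_set A) (\<lambda>x. exp (l * \<theta> * (f x - ?\<mu> A)) *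
      measure_pmf.expectation (pmf_of_set (permutations_of_set (A - {x})))
      (\<lambda>ys. exp (l * ((\<Sum>t<L. f (ys ! t)) - L * ?\<mu> (A - {x})))))"
  proof (intro integral_cong_AE)
    have "exp (l * (f x + S - Suc L * ?\<mu> A)) = exp (l * \<theta> * (f x - ?\<mu> A)) * exp (l * (S - L * ?\<mu> (A - {x})))"
      if "x \<in> A" for x S
      by (simp only: dev[OF that] distrib_left exp_add mult.assoc)
    then show "AE x in measure_pmf (pmf_of_set A).
        measure_pmf.expectation (pmf_of_set (permutations_of_set (A - {x})))
          (\<lambda>ys. exp (l * (f x + (\<Sum>t<L. f (ys ! t)) - Suc L * ?\<mu> A))) =
        exp (l * \<theta> * (f x - ?\<mu> A)) * measure_pmf.expectation (pmf_of_set (permutations_of_set (A - {x})))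
          (\<lambda>ys. exp (l * ((\<Sum>t<L. f (ys ! t)) - L * ?\<mu> (A - {x}))))"
      unfolding AE_measure_pmf_iff using A by (simp del: of_nat_Suc)
  qed simp_all
  \<comment> \<open>The bound from the induction hypothesis does not depend on \<open>x\<close>, so
    it can be pulled out of the expectation; Hoeffding's lemma with \<open>l * \<theta>\<close>
    handles the rest.\<close>
  also have "\<dots> \<le> measure_pmf.expectation (pmf_of_set A) (\<lambda>x. exp (l * \<theta> * (f x - ?\<mu> A)) * exp (l\<^sup>2 * L / 8))"
  proof (rule integral_mono_AE)
    have "measure_pmf.expectation (pmf_of_set (permutations_of_set (A - {x})))
        (\<lambda>ys. exp (l * ((\<Sum>t<L. f (ys ! t)) - L * ?\<mu> (A - {x})))) \<le> exp (l\<^sup>2 * L / 8)"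
      if "x \<in> A" for x
      by (rule Suc.IH) (use that Suc.prems in auto)
    then show "AE x in measure_pmf (pmf_of_set A). exp (l * \<theta> * (f x - ?\<mu> A)) *
        measure_pmf.expectation (pmf_of_set (permutations_of_set (A - {x})))
          (\<lambda>ys. exp (l * ((\<Sum>t<L. f (ys ! t)) - L * ?\<mu> (A - {x})))) \<le>
        exp (l * \<theta> * (f x - ?\<mu> A)) * exp (l\<^sup>2 * L / 8)"
      unfolding AE_measure_pmf_iff using A by (auto intro!: mult_left_mono)
  qed (use A in \<open>simp_all add: integrable_measure_pmf_finite\<close>)
  also have "\<dots> \<le> exp ((l * \<theta>)\<^sup>2 / 8) * exp (l\<^sup>2 * L / 8)"
    using exp_moment_uniform_le[OF A, of f "l * \<theta>"] Suc.prems(3) by simp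
  also have "\<dots> \<le> exp (l\<^sup>2 / 8) * exp (l\<^sup>2 * L / 8)"
    using \<theta> by (simp add: power_mult_distrib mult_left_le abs_square_le_1)
  also have "\<dots> = exp (l\<^sup>2 * Suc L / 8)"
    by (simp add: field_simps flip: exp_add)
  finally show ?case .
qed simp

section \<open>Blocks at arbitrary positions\<close>

lemma map_rotate_pmf_of_set_permutations_of_set:
  assumes "finite A"
  shows "map_pmf (rotate s) (pmf_of_set (permutations_of_set A)) = pmf_of_set (permutations_of_set A)"
proof -
  have "inj (rotate s :: 'a list \<Rightarrow> 'a list)"
    by (simp add: rotate_def inj_rotate1)
  then have inj: "inj_on (rotate s) (permutations_of_set A)"
    by (rule inj_on_subset) simp
  have "rotate s ` permutations_of_set A \<subseteq> permutations_of_set A"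
    by (auto simp: permutations_of_set_def)
  then have "rotate s ` permutations_of_set A = permutations_of_set A"
    using inj by (intro endo_inj_surj) simp_all
  then show ?thesis
    using assms inj by (simp add: map_pmf_of_set_inj)
qed

text \<open>Rotating by \<open>s\<close> moves the block to the front without changing the
  distribution; \<open>s + L \<le> card A\<close> rules out wrapping around.\<close>

lemma exp_moment_permutation_block_le:
  fixes f :: "'a \<Rightarrow> real"
  assumes A: "finite A" and L: "s + L \<le> card A" and f: "\<And>x. x \<in> A \<Longrightarrow> f x \<in> {0..1}"
  shows "measure_pmf.expectation (pmf_of_set (permutations_of_set A))
    (\<lambda>xs. exp (l * ((\<Sum>t\<in>{s..<s+L}. f (xs ! t)) - L * ((\<Sum>x\<in>A. f x) / card A)))) \<le> exp (l\<^sup>2 * L / 8)"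
proof -
  let ?p = "pmf_of_set (permutations_of_set A)"
  have "(\<Sum>t\<in>{s..<s+L}. f (xs ! t)) = (\<Sum>t<L. f (rotate s xs ! t))" if "xs \<in> permutations_of_set A" for xs
  proof -
    have "(\<Sum>t\<in>{s..<s+L}. f (xs ! t)) = (\<Sum>t<L. f (xs ! (t + s)))"
      using sum.shift_bounds_nat_ivl[of "\<lambda>t. f (xs ! t)" 0 s L] by (simp add: atLeast0LessThan add.commute)
    also have "\<dots> = (\<Sum>t<L. f (rotate s xs ! t))"
      using L that by (intro sum.cong) (auto simp: nth_rotate length_finite_permutations_of_set add.commute)
    finally show ?thesis .
  qed
  then have "measure_pmf.expectation ?p (\<lambda>xs. exp (l * ((\<Sum>t\<in>{s..<s+L}. f (xs ! t)) - L * ((\<Sum>x\<in>A. f x) / card A)))) =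
     measure_pmf.expectation (map_pmf (rotate s) ?p) (\<lambda>xs. exp (l * ((\<Sum>t<L. f (xs ! t)) - L * ((\<Sum>x\<in>A. f x) / card A))))"
    using A by (simp add: integral_pmf_of_set)
  then show ?thesis
    using exp_moment_permutation_prefix_le[OF A, of L f l] L f
    by (simp add: map_rotate_pmf_of_set_permutations_of_set[OF A])
qed

text \<open>The maximum is controlled through the sum of exponentials, so the \<open>Z i\<close> may
  depend on each other in any way.\<close>

lemma expectation_Max_le:
  fixes Z :: "'b \<Rightarrow> 'a \<Rightarrow> real"
  assumes p: "finite (set_pmf p)" and I: "finite I" "I \<noteq> {}" and l: "l > 0"
    and mgf: "\<And>i. i \<in> I \<Longrightarrow> measure_pmf.expectation p (\<lambda>x. exp (l * Z i x)) \<le> exp v"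
  shows "measure_pmf.expectation p (\<lambda>x. Max ((\<lambda>i. Z i x) ` I)) \<le> (ln (card I) + v) / l"
proof -
  \<comment> \<open>An upper bound for the expected sum of exponentials, hence the natural point of
    tangency for the logarithm.\<close>
  define C where "C = real (card I) * exp v"
  have "C > 0" using I by (simp add: C_def card_gt_0_iff)
  have "Max ((\<lambda>i. Z i x) ` I) \<le> ((\<Sum>i\<in>I. exp (l * Z i x)) / C + (ln C - 1)) / l" for x
  proof -
    have "Z j x \<le> ((\<Sum>i\<in>I. exp (l * Z i x)) / C + (ln C - 1)) / l" if j: "j \<in> I" for j
    proof -
      \<comment> \<open>Linearising the logarithm at \<open>C\<close> pathwise replaces Jensen's inequality.\<close>
      have "l * Z j x - ln C = ln (exp (l * Z j x) / C)"
        using \<open>C > 0\<close> by (simp add: ln_div)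
      also have "\<dots> \<le> exp (l * Z j x) / C - 1"
        using \<open>C > 0\<close> by (intro ln_le_minus_one) simp
      also have "\<dots> \<le> (\<Sum>i\<in>I. exp (l * Z i x)) / C - 1"
        using j I \<open>C > 0\<close> member_le_sum[of j I "\<lambda>i. exp (l * Z i x)"] by (simp add: divide_right_mono)
      finally show ?thesis using l by (simp add: field_simps)
    qed
    then show ?thesis using I by simp
  qed
  then have "measure_pmf.expectation p (\<lambda>x. Max ((\<lambda>i. Z i x) ` I)) \<le>
      measure_pmf.expectation p (\<lambda>x. ((\<Sum>i\<in>I. exp (l * Z i x)) / C + (ln C - 1)) / l)"
    using p by (intro integral_mono integrable_measure_pmf_finite) auto
  also have "\<dots> = ((\<Sum>i\<in>I. measure_pmf.expectation p (\<lambda>x. exp (l * Z i x))) / C + (ln C - 1)) / l"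
    using p by (simp add: integrable_measure_pmf_finite Bochner_Integration.integral_sum)
  also have "\<dots> \<le> (C / C + (ln C - 1)) / l"
    using mgf sum_mono[of I "\<lambda>i. measure_pmf.expectation p (\<lambda>x. exp (l * Z i x))" "\<lambda>_. exp v"] \<open>C > 0\<close> l
    by (intro divide_right_mono add_mono) (auto simp: C_def)
  also have "\<dots> = (ln (card I) + v) / l"
    using I \<open>C > 0\<close> by (simp add: C_def ln_mult card_gt_0_iff)
  finally show ?thesis .
qed

text \<open>Each expert may have its own block, as in the tests of the pools, or all may share one,
  as in a phase in which the leader is followed. The sign \<open>\<sigma>\<close> covers deviations
  in both directions.\<close>

lemma expectation_Max_block_deviation_le:
  fixes c :: "'a \<Rightarrow> nat \<Rightarrow> real"
  assumes A: "finite A" and n: "n \<ge> 2" and L: "\<And>i. i < n \<Longrightarrow> s i + L \<le> card A"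
    and c: "\<And>x i. x \<in> A \<Longrightarrow> i < n \<Longrightarrow> c x i \<in> {0..1}" and \<sigma>: "\<sigma> \<in> {-1, 1}"
  shows "measure_pmf.expectation (pmf_of_set (permutations_of_set A))
    (\<lambda>xs. Max ((\<lambda>i. \<sigma> * ((\<Sum>t\<in>{s i..<s i + L}. c (xs ! t) i) - L * ((\<Sum>x\<in>A. c x i) / card A))) ` {..<n}))
    \<le> sqrt (L * ln n)"
proof (cases "L = 0")
  case False
  \<comment> \<open>The minimiser of \<open>ln n / l + l * L / 8\<close> is
    \<open>sqrt (8 * ln n / L)\<close>; this simpler value yields
    \<open>3 / 4 * sqrt (L * ln n)\<close>, which suffices.\<close>
  define l where "l = 2 * sqrt (ln n / L)"
  have pos: "ln n > 0" "real L > 0" using n False by auto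
  then have l: "l > 0" by (simp add: l_def)
  have "measure_pmf.expectation (pmf_of_set (permutations_of_set A))
    (\<lambda>xs. Max ((\<lambda>i. \<sigma> * ((\<Sum>t\<in>{s i..<s i + L}. c (xs ! t) i) - L * ((\<Sum>x\<in>A. c x i) / card A))) ` {..<n}))
    \<le> (ln (card {..<n}) + l\<^sup>2 * L / 8) / l"
  proof (rule expectation_Max_le)
    fix i assume "i \<in> {..<n}"
    then have "measure_pmf.expectation (pmf_of_set (permutations_of_set A))
       (\<lambda>xs. exp (l * \<sigma> * ((\<Sum>t\<in>{s i..<s i + L}. c (xs ! t) i) - L * ((\<Sum>x\<in>A. c x i) / card A)))) \<le>
       exp ((l * \<sigma>)\<^sup>2 * L / 8)"
      using A L c by (intro exp_moment_permutation_block_le) auto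
    then show "measure_pmf.expectation (pmf_of_set (permutations_of_set A))
       (\<lambda>xs. exp (l * (\<sigma> * ((\<Sum>t\<in>{s i..<s i + L}. c (xs ! t) i) - L * ((\<Sum>x\<in>A. c x i) / card A))))) \<le>
       exp (l\<^sup>2 * L / 8)"
      using \<sigma> by (auto simp: mult.assoc)
  qed (use A n l in \<open>auto simp: lessThan_empty_iff\<close>)
  also have "\<dots> \<le> sqrt (L * ln n)"
  proof -
    have "l\<^sup>2 * L = 4 * ln n" using pos by (simp add: l_def power_mult_distrib)
    moreover have "sqrt (L * ln n) * l = 2 * ln n"
      using pos by (simp add: l_def real_sqrt_mult real_sqrt_divide)
    ultimately show ?thesis using l pos by (simp add: pos_divide_le_eq)
  qed
  finally show ?thesis .
qed (use A n in \<open>simp add: lessThan_empty_iff\<close>)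

section \<open>The exploration algorithm\<close>

text \<open>
  The memory holds the number \<open>i\<close> of the next cost, the day \<open>q\<close> of the current block, the pool \<open>p\<close> under
  test, the block length \<open>l = 2 ^ j\<close> of phase \<open>j\<close>, the expert \<open>ld\<close> being followed, the best expert \<open>cand\<close>
  tested so far in this phase with its score \<open>best\<close>, and \<open>k\<close> counters. Expert \<open>i\<close> uses counter \<open>i mod k\<close>
  while pool \<open>i div k\<close> is tested. Counters and \<open>best\<close> are never cleared: \<open>q = 0\<close> makes a counter start
  afresh, and expert \<open>0\<close>, the first one tested in each phase, always replaces the candidate.
\<close>

fun explore_read :: "nat \<Rightarrow> nat \<Rightarrow> memory \<Rightarrow> real \<Rightarrow> memory" where
  "explore_read k N (i # q # p # l # ld # cand # best # cs) r =
     (if i div k = p then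
        let v = (if q = 0 then 0 else cs ! (i mod k)) + nat \<lfloor>r * real N\<rfloor>;
            better = (q + 1 = l \<and> (i = 0 \<or> v < best))
        in (i + 1) # q # p # l # ld # (if better then i else cand) # (if better then v else best) #
           cs[i mod k := v]
      else (i + 1) # q # p # l # ld # cand # best # cs)"
| "explore_read k N m r = m"

text \<open>The stream carries no end-of-day mark, so this is applied after every cost and acts once
  all \<open>n\<close> costs of the day have been counted.\<close>

fun explore_turn :: "nat \<Rightarrow> nat \<Rightarrow> memory \<Rightarrow> memory" where
  "explore_turn n P (i # q # p # l # ld # cand # best # cs) =
     (if i < n then i # q # p # l # ld # cand # best # cs
      else if q + 1 < l then 0 # (q + 1) # p # l # ld # cand # best # cs
      else if p + 1 < P then 0 # 0 # (p + 1) # l # ld # cand # best # cs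
      else 0 # 0 # 0 # (2 * l) # cand # cand # best # cs)"
| "explore_turn n P m = m"

text \<open>
  On the memories that a run can reach the guard never intervenes; it is needed because a streaming
  algorithm has to respect the word size from every memory.
\<close>

definition guarded :: "nat \<Rightarrow> nat \<Rightarrow> (memory \<Rightarrow> real \<Rightarrow> memory) \<Rightarrow> memory \<Rightarrow> real \<Rightarrow> memory" where
  "guarded s b g m r = (if g m r \<in> memories s b then g m r else m)"

definition explore_initial :: "nat \<Rightarrow> memory" where
  "explore_initial k = [0, 0, 0, 1, 0, 0, 0] @ replicate k 0"

text \<open>
  The first day of the block in which phase \<open>j\<close> tests pool \<open>p\<close>. A phase has \<open>P\<close> blocks of \<open>2 ^ j\<close> days, so
  \<open>P * (1 + 2 + \<dots> + 2 ^ (j - 1))\<close> days precede phase \<open>j\<close>.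
\<close>

definition block_start :: "nat \<Rightarrow> nat \<Rightarrow> nat \<Rightarrow> nat" where
  "block_start P j p = P * (2 ^ j - 1) + p * 2 ^ j"

lemma block_start_Suc: "block_start P (Suc j) 0 = block_start P j 0 + P * 2 ^ j"
proof -
  have "2 ^ Suc j - 1 = (2 ^ j - 1) + (2::nat) ^ j" by (simp add: mult_2)
  then show ?thesis by (simp only: block_start_def distrib_left mult_0 add_0_right)
qed

lemma block_end_le:
  assumes "p < P"
  shows "block_start P j p + 2 ^ j \<le> block_start P (Suc j) 0"
proof -
  have "(p + 1) * 2 ^ j \<le> P * 2 ^ j"
    using assms by (intro mult_le_mono1) simp
  then show ?thesis unfolding block_start_Suc by (simp add: block_start_def)
qed

text \<open>The order of the days is fixed here, and the run is deterministic. The three word bounds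
  serve expert numbers, counters (at most \<open>T\<close> days of at most \<open>T\<close> units)
  and block lengths.\<close>

locale exploration =
  fixes n P k T b :: nat and f :: "nat \<Rightarrow> nat \<Rightarrow> real"
  assumes n: "n > 0" and P: "P > 0" and k: "k > 0" and pools: "n \<le> k * P"
    and word: "n < 2 ^ b" "T * T < 2 ^ b" "T + 1 < 2 ^ b"
    and f: "\<And>t i. t < T \<Longrightarrow> i < n \<Longrightarrow> f t i \<in> {0..1}"
begin

definition w :: "nat \<Rightarrow> nat \<Rightarrow> nat" where "w t i = nat \<lfloor>f t i * real T\<rfloor>"

abbreviation start :: "nat \<Rightarrow> nat \<Rightarrow> nat" where "start \<equiv> block_start P"

definition score :: "nat \<Rightarrow> nat \<Rightarrow> nat" where
  "score j e = (\<Sum>t\<in>{start j (e div k)..<start j (e div k) + 2 ^ j}. w t e)"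

definition step :: "memory \<Rightarrow> real \<Rightarrow> memory" where
  "step = guarded (7 + k) b (\<lambda>m r. explore_turn n P (explore_read k T m r))"

definition M :: "nat \<Rightarrow> memory" where "M t = table_after step (explore_initial k) n f t"

text \<open>Singles out the experts whose score in phase \<open>j\<close> is already final.\<close>

definition tested :: "nat \<Rightarrow> nat \<Rightarrow> nat \<Rightarrow> nat \<Rightarrow> nat \<Rightarrow> bool" where
  "tested j p q i e \<longleftrightarrow> e div k < p \<or> e div k = p \<and> q + 1 = 2 ^ j \<and> e < i"

text \<open>Phase \<open>0\<close> has no earlier tests to rely on, hence the restriction to
  \<open>j > 0\<close>.\<close>

definition good_leader :: "nat \<Rightarrow> nat \<Rightarrow> bool" where
  "good_leader j ld \<longleftrightarrow> ld < n \<and> (\<forall>e<n. j > 0 \<longrightarrow> score (j - 1) ld \<le> score (j - 1) e)"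

text \<open>Counters are described only for the pool under test, and on the first day of a block
  only after the expert's cost was read, since until then they are stale. Once expert
  \<open>0\<close> is tested, the last two clauses make the score of \<open>cand\<close> a lower
  bound for the scores of all tested experts. Membership in \<open>memories\<close> shows that the
  guard does not intervene.\<close>

definition state_ok :: "nat \<Rightarrow> nat \<Rightarrow> nat \<Rightarrow> nat \<Rightarrow> nat \<Rightarrow> memory \<Rightarrow> bool" where
  "state_ok ld j p q i m \<longleftrightarrow> m \<in> memories (7 + k) b \<and> good_leader j ld \<and> p < P \<and> q < 2 ^ j \<and>
     (\<exists>cand best cs. m = i # q # p # 2 ^ j # ld # cand # best # cs \<and> length cs = k \<and> cand < n \<and>
       (\<forall>e<n. e div k = p \<longrightarrow> q > 0 \<or> e < i \<longrightarrow>
          cs ! (e mod k) = (\<Sum>t\<in>{start j p..<start j p + q + (if e < i then 1 else 0)}. w t e)) \<and>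
       (\<forall>e<n. tested j p q i e \<longrightarrow> best \<le> score j e) \<and>
       (tested j p q i 0 \<longrightarrow> score j cand = best))"

section \<open>Preservation of the invariant\<close>

lemma pool_less: "e < n \<Longrightarrow> e div k < P"
  using pools k by (simp add: less_mult_imp_div_less mult.commute)

lemma w_le: "t < T \<Longrightarrow> i < n \<Longrightarrow> w t i \<le> T"
proof -
  assume "t < T" "i < n"
  then have "f t i * real T \<le> 1 * real T" using f[of t i] by (intro mult_right_mono) auto
  then have "\<lfloor>f t i * real T\<rfloor> \<le> int T" by linarith
  then show ?thesis by (simp add: w_def)
qed

text \<open>At least \<open>2 ^ j - 1\<close> days precede phase \<open>j\<close>, so a block length
  that is reached within the stream is at most \<open>T + 1\<close>.\<close>

lemma two_power_le: "2 ^ j \<le> start j p + 1"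
proof -
  have "1 * (2 ^ j - 1) \<le> P * (2 ^ j - 1)" using P by (intro mult_le_mono1) auto
  then show ?thesis unfolding block_start_def by linarith
qed

lemma state_ok_read:
  assumes ok: "state_ok ld j p q i m" and i: "i < n" and t: "start j p + q < T"
  shows "state_ok ld j p q (i + 1) (explore_read k T m (f (start j p + q) i))"
proof -
  from ok obtain cand best cs where m: "m = i # q # p # 2 ^ j # ld # cand # best # cs"
    and len: "length cs = k" and cand: "cand < n"
    and cs: "\<And>e. e < n \<Longrightarrow> e div k = p \<Longrightarrow> q > 0 \<or> e < i \<Longrightarrow>
      cs ! (e mod k) = (\<Sum>t\<in>{start j p..<start j p + q + (if e < i then 1 else 0)}. w t e)"
    and best: "\<And>e. e < n \<Longrightarrow> tested j p q i e \<Longrightarrow> best \<le> score j e"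
    and best_cand: "tested j p q i 0 \<Longrightarrow> score j cand = best"
    and mem: "m \<in> memories (7 + k) b" and gl: "good_leader j ld" "p < P" "q < 2 ^ j"
    unfolding state_ok_def by blast
  let ?t = "start j p + q"
  have i1: "i + 1 < 2 ^ b" using i word by linarith
  show ?thesis
  proof (cases "i div k = p")
    case False
    have "tested j p q (i + 1) e \<longleftrightarrow> tested j p q i e" for e
      using False by (auto simp: tested_def less_Suc_eq)
    moreover have "e < i + 1 \<longleftrightarrow> e < i" if "e div k = p" for e
      using False that by (auto simp: less_Suc_eq)
    ultimately show ?thesis
      using False m len cand cs best best_cand mem gl i1 unfolding state_ok_def memories_def by auto
  next
    case True
    define v where "v = (\<Sum>t\<in>{start j p..<start j p + q + 1}. w t i)"
    have v: "(if q = 0 then 0 else cs ! (i mod k)) + nat \<lfloor>f ?t i * real T\<rfloor> = v"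
      using cs[OF i True] by (simp add: v_def w_def)
    have "v \<le> (\<Sum>t\<in>{start j p..<start j p + q + 1}. T)"
      unfolding v_def using t i by (intro sum_mono w_le) auto
    also have "\<dots> \<le> T * T"
    proof -
      have "q + 1 \<le> T" using two_power_le[of j p] t gl(3) by linarith
      then show ?thesis using mult_le_mono1[of "q + 1" T T] by simp
    qed
    finally have v_word: "v < 2 ^ b" using word by linarith
    define better where "better \<longleftrightarrow> q + 1 = 2 ^ j \<and> (i = 0 \<or> v < best)"
    have eq: "explore_read k T m (f ?t i) = (i + 1) # q # p # 2 ^ j # ld #
        (if better then i else cand) # (if better then v else best) # cs[i mod k := v]"
      using True v by (simp add: m better_def Let_def)
    \<comment> \<open>Experts of one pool have distinct counters, so writing the counter of
      \<open>i\<close> disturbs no other value that the invariant describes.\<close>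
    have slot: "e mod k = i mod k \<longleftrightarrow> e = i" if "e div k = p" for e
      using that True by (metis div_mult_mod_eq)
    have "cs[i mod k := v] ! (e mod k) = (\<Sum>t\<in>{start j p..<start j p + q + (if e < i + 1 then 1 else 0)}. w t e)"
      if e: "e < n" "e div k = p" "q > 0 \<or> e < i + 1" for e
    proof (cases "e = i")
      case True
      then show ?thesis using len k by (simp add: v_def)
    next
      case False
      then have "cs[i mod k := v] ! (e mod k) = cs ! (e mod k)"
        using slot[OF e(2)] by (metis nth_list_update_neq)
      then show ?thesis using cs[OF e(1,2)] False e(3) by (auto simp: less_Suc_eq)
    qed
    moreover have v_score: "v = score j i" if "q + 1 = 2 ^ j"
      using that True by (simp add: v_def score_def add.assoc flip: that)
    have tested_Suc: "tested j p q (i + 1) e \<longleftrightarrow> tested j p q i e \<or> (q + 1 = 2 ^ j \<and> e = i)" for e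
      using True by (auto simp: tested_def less_Suc_eq)
    \<comment> \<open>When expert \<open>0\<close> is read nothing has been tested in this phase, so
      replacing a stale \<open>best\<close> is sound; by \<open>first\<close>, every later final
      score is compared with a valid \<open>best\<close>.\<close>
    have none: "\<not> tested j p q i e" if "i = 0" for e
      using that True by (auto simp: tested_def)
    have first: "tested j p q i 0" if "i > 0" "q + 1 = 2 ^ j"
      using that True by (auto simp: tested_def)
    have "(if better then v else best) \<le> score j e" if "e < n" "tested j p q (i + 1) e" for e
      using that best[of e] v_score none unfolding tested_Suc better_def by (fastforce simp: not_less)
    moreover have "score j (if better then i else cand) = (if better then v else best)"
      if "tested j p q (i + 1) 0"
      using that best_cand v_score none first unfolding tested_Suc better_def by (cases "i = 0") auto
    moreover have "explore_read k T m (f ?t i) \<in> memories (7 + k) b"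
    proof -
      have "set (cs[i mod k := v]) \<subseteq> insert v (set cs)" by (rule set_update_subset_insert)
      moreover have "\<forall>x\<in>set cs. x < 2 ^ b" "q < 2 ^ b" "p < 2 ^ b" "2 ^ j < (2::nat) ^ b"
          "ld < 2 ^ b" "cand < 2 ^ b" "best < 2 ^ b"
        using mem unfolding m memories_def by simp_all
      ultimately show ?thesis
        using i1 v_word len i word(1) unfolding eq memories_def by auto
    qed
    ultimately show ?thesis
      unfolding state_ok_def using eq len gl i cand by auto
  qed
qed

text \<open>The next day belongs to the same block, to the next pool or to the next phase. The final
  disjunction records that a new leader can appear only on the first day of a phase.\<close>

lemma state_ok_turn:
  assumes ok: "state_ok ld j p q n m" and t: "start j p + q < T"
  shows "\<exists>ld' j' p' q'. start j' p' + q' = start j p + q + 1 \<and> state_ok ld' j' p' q' 0 (explore_turn n P m) \<and>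
    (j' = j \<and> ld' = ld \<or> p' = 0 \<and> q' = 0)"
proof -
  from ok obtain cand best cs where m: "m = n # q # p # 2 ^ j # ld # cand # best # cs"
    and len: "length cs = k" and cand: "cand < n"
    and cs: "\<And>e. e < n \<Longrightarrow> e div k = p \<Longrightarrow> cs ! (e mod k) = (\<Sum>t\<in>{start j p..<start j p + q + 1}. w t e)"
    and best: "\<And>e. e < n \<Longrightarrow> tested j p q n e \<Longrightarrow> best \<le> score j e"
    and best_cand: "tested j p q n 0 \<Longrightarrow> score j cand = best"
    and mem: "m \<in> memories (7 + k) b" and gl: "good_leader j ld" "p < P" "q < 2 ^ j"
    unfolding state_ok_def by auto
  have words: "\<forall>x\<in>set cs. x < 2 ^ b" "q < 2 ^ b" "p < 2 ^ b" "2 ^ j < (2::nat) ^ b"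
      "ld < 2 ^ b" "cand < 2 ^ b" "best < 2 ^ b" "0 < (2::nat) ^ b"
    using mem unfolding m memories_def by simp_all
  consider "q + 1 < 2 ^ j" | "q + 1 = 2 ^ j" "p + 1 < P" | "q + 1 = 2 ^ j" "p + 1 = P"
    using gl by linarith
  then show ?thesis
  proof cases
    case 1
    have "q + 1 < 2 ^ b" using 1 words(4) by linarith
    moreover have "tested j p (q + 1) 0 e \<Longrightarrow> tested j p q n e" for e
      using 1 by (auto simp: tested_def)
    ultimately have "state_ok ld j p (q + 1) 0 (explore_turn n P m)"
      using 1 m len cand cs best best_cand gl words unfolding state_ok_def memories_def
      by (auto simp del: power_strict_increasing_iff)
    then show ?thesis by (metis add.assoc)
  next
    case 2
    have "p \<le> start j p" by (simp add: block_start_def trans_le_add2)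
    then have "p + 1 < 2 ^ b" using t word(3) by linarith
    moreover have "tested j (p + 1) 0 0 e \<Longrightarrow> e < n \<Longrightarrow> tested j p q n e" for e
      using 2 by (auto simp: tested_def less_Suc_eq)
    ultimately have "state_ok ld j (p + 1) 0 0 (explore_turn n P m)"
      using 2 m len cand best best_cand gl words n unfolding state_ok_def memories_def by auto
    moreover have "start j (p + 1) + 0 = start j p + q + 1"
      using 2 by (simp add: block_start_def)
    ultimately show ?thesis by blast
  next
    case 3
    have st: "start (j + 1) 0 + 0 = start j p + q + 1"
    proof -
      have "p * 2 ^ j + (q + 1) = P * 2 ^ j"
        by (simp only: 3(1) flip: 3(2)) simp
      then show ?thesis
        unfolding Suc_eq_plus1[symmetric] block_start_Suc by (simp add: block_start_def)
    qed
    \<comment> \<open>The doubled block length is stored even if the stream ends with this day;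
      hence \<open>T + 1\<close> in the word bound.\<close>
    have "2 ^ (j + 1) \<le> T + 1"
      using two_power_le[of "j + 1" 0] st t by simp
    then have pw: "2 * 2 ^ j < (2::nat) ^ b"
      using word(3) by (simp only: power_Suc flip: Suc_eq_plus1)
    \<comment> \<open>The last pool has finished its block, so every expert is tested and
      \<open>cand\<close> minimises the score of phase \<open>j\<close>.\<close>
    have all: "tested j p q n e" if "e < n" for e
      using pool_less[OF that] 3 that by (auto simp: tested_def)
    have "good_leader (j + 1) cand"
      using best[OF _ all] best_cand[OF all[OF n]] cand unfolding good_leader_def by auto
    moreover have "\<not> tested (j + 1) 0 0 0 e" for e by (simp add: tested_def)
    ultimately have "state_ok cand (j + 1) 0 0 0 (explore_turn n P m)"
      using 3 m len cand words P pw unfolding state_ok_def memories_def by auto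
    with st show ?thesis by blast
  qed
qed

text \<open>Slot \<open>4\<close> of the memory is that of \<open>ld\<close>.\<close>

definition leader :: "nat \<Rightarrow> nat" where "leader j = M (start j 0) ! 4"

lemma state_ok_day:
  assumes ok: "state_ok ld j p q 0 (M t)" and t: "t = start j p + q" "t < T"
  shows "\<exists>ld' j' p' q'. t + 1 = start j' p' + q' \<and> state_ok ld' j' p' q' 0 (M (t + 1)) \<and>
    (j' = j \<and> ld' = ld \<or> p' = 0 \<and> q' = 0)"
proof -
  have step_eq: "step m r = explore_turn n P (explore_read k T m r)"
    if "state_ok ld' j' p' q' i' (explore_turn n P (explore_read k T m r))" for ld' j' p' q' i' m r
    using that by (auto simp: step_def guarded_def state_ok_def)
  \<comment> \<open>The last cost of the day is left out, because only after it does
    \<open>explore_turn\<close> change the memory.\<close>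
  have upto: "state_ok ld j p q i (foldl step (M t) (map (f t) [0..<i]))" if "i < n" for i
    using that
  proof (induction i)
    case (Suc i)
    let ?m = "foldl step (M t) (map (f t) [0..<i])"
    have ok': "state_ok ld j p q (i + 1) (explore_read k T ?m (f t i))"
      using state_ok_read[of ld j p q i ?m] Suc t by simp
    moreover have "explore_turn n P (explore_read k T ?m (f t i)) = explore_read k T ?m (f t i)"
      using ok' Suc.prems unfolding state_ok_def by auto
    ultimately show ?case using step_eq[of ld j p q "i + 1" ?m "f t i"] by simp
  qed (use ok in simp)
  let ?m = "foldl step (M t) (map (f t) [0..<n - 1])"
  have "state_ok ld j p q n (explore_read k T ?m (f t (n - 1)))"
    using state_ok_read[OF upto[of "n - 1"]] n t by simp
  from state_ok_turn[OF this] t obtain ld' j' p' q' where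
    "start j' p' + q' = t + 1" and ok': "state_ok ld' j' p' q' 0 (explore_turn n P (explore_read k T ?m (f t (n - 1))))"
    and "j' = j \<and> ld' = ld \<or> p' = 0 \<and> q' = 0"
    by auto
  moreover have "M (t + 1) = step ?m (f t (n - 1))"
  proof -
    have "[0..<n] = [0..<n - 1] @ [n - 1]" using n by (metis Suc_diff_1 upt_Suc_append zero_le)
    then show ?thesis by (simp add: M_def table_after_Suc)
  qed
  ultimately show ?thesis
    using step_eq[OF ok'] by metis
qed

lemma state_ok_M:
  assumes "t \<le> T"
  shows "\<exists>j p q. t = start j p + q \<and> state_ok (leader j) j p q 0 (M t)"
  using assms
proof (induction t)
  case 0
  have "state_ok 0 0 0 0 0 (M 0)"
    using n P word by (auto simp: state_ok_def M_def explore_initial_def memories_def good_leader_def tested_def)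
  moreover have "leader 0 = 0" by (simp add: leader_def block_start_def M_def explore_initial_def)
  ultimately show ?case by (metis add_0 mult_0 mult_0_right block_start_def diff_self_eq_0 power_0)
next
  case (Suc t)
  then obtain j p q where "t = start j p + q" "state_ok (leader j) j p q 0 (M t)" by auto
  then have "\<exists>ld' j' p' q'. t + 1 = start j' p' + q' \<and> state_ok ld' j' p' q' 0 (M (t + 1)) \<and>
      (j' = j \<and> ld' = leader j \<or> p' = 0 \<and> q' = 0)"
    using Suc.prems by (intro state_ok_day) auto
  then obtain ld' j' p' q' where *: "t + 1 = start j' p' + q'" "state_ok ld' j' p' q' 0 (M (t + 1))"
    "j' = j \<and> ld' = leader j \<or> p' = 0 \<and> q' = 0"
    by blast
  \<comment> \<open>Either the phase goes on with the same leader, or phase \<open>j'\<close> begins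
    on this very day and \<open>leader j'\<close> is by definition read off this memory.\<close>
  have "ld' = leader j'"
    using * by (auto simp: leader_def state_ok_def)
  with * show ?case by auto
qed

text \<open>Phases occupy disjoint intervals of days, so the phase supplied by
  \<open>state_ok_M\<close> must be \<open>j\<close>.\<close>

lemma leader_phase:
  assumes t: "start j 0 \<le> t" "t < start (Suc j) 0" "t \<le> T"
  shows "M t ! 4 = leader j" "good_leader j (leader j)"
proof -
  obtain i p q where i: "t = start i p + q" "state_ok (leader i) i p q 0 (M t)"
    using state_ok_M[OF t(3)] by blast
  have mono: "start a 0 \<le> start b 0" if "a \<le> b" for a b
    using that by (simp add: block_start_def diff_le_mono)
  have "start i 0 \<le> t" using i by (simp add: block_start_def)
  moreover have "t < start (Suc i) 0"
  proof -
    have "p + 1 \<le> P" "q < 2 ^ i" using i by (auto simp: state_ok_def)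
    then have "p * 2 ^ i + q < P * 2 ^ i"
      using mult_le_mono1[of "p + 1" P "2 ^ i"] by simp
    then show ?thesis unfolding block_start_Suc using i by (simp add: block_start_def)
  qed
  ultimately have "i = j"
    using t mono[of "Suc i" j] mono[of "Suc j" i] by (meson leD less_le_trans not_less_eq_eq le_antisym)
  then show "M t ! 4 = leader j" "good_leader j (leader j)"
    using i by (auto simp: state_ok_def)
qed

end

section \<open>Regret of the exploration algorithm\<close>

text \<open>Each of the \<open>2 ^ j\<close> roundings loses at most one unit of
  \<open>1 / T\<close>.\<close>

lemma (in exploration) score_bounds:
  assumes "start (Suc j) 0 \<le> T" "e < n"
  shows "real (score j e) \<le> T * (\<Sum>t\<in>{start j (e div k)..<start j (e div k) + 2 ^ j}. f t e)"
    and "T * (\<Sum>t\<in>{start j (e div k)..<start j (e div k) + 2 ^ j}. f t e) \<le> real (score j e) + 2 ^ j"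
proof -
  let ?B = "{start j (e div k)..<start j (e div k) + 2 ^ j}"
  have "start j (e div k) + 2 ^ j \<le> T"
    using block_end_le[OF pool_less[OF assms(2)], of j] assms(1) by linarith
  then have "t < T" if "t \<in> ?B" for t using that by simp
  then have *: "real (w t e) \<le> T * f t e" "T * f t e \<le> real (w t e) + 1" if "t \<in> ?B" for t
    using that f[of t e] assms(2) unfolding w_def by (auto simp: mult.commute) 
  show "real (score j e) \<le> T * (\<Sum>t\<in>?B. f t e)"
    unfolding score_def of_nat_sum sum_distrib_left by (intro sum_mono *)
  have "T * (\<Sum>t\<in>?B. f t e) \<le> (\<Sum>t\<in>?B. real (w t e) + 1)"
    unfolding sum_distrib_left by (intro sum_mono *)
  then show "T * (\<Sum>t\<in>?B. f t e) \<le> real (score j e) + 2 ^ j"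
    by (simp add: score_def sum.distrib)
qed

locale shuffled_exploration =
  fixes n P k T b :: nat and c :: "nat \<Rightarrow> nat \<Rightarrow> real"
  assumes n: "n \<ge> 2" and P: "P > 0" "P \<le> T" and k: "k > 0" and pools: "n \<le> k * P"
    and word: "n < 2 ^ b" "T * T < 2 ^ b" "T + 1 < 2 ^ b"
    and c: "\<And>t i. t < T \<Longrightarrow> i < n \<Longrightarrow> c t i \<in> {0..1}"
begin

abbreviation orders :: "nat list pmf" where "orders \<equiv> pmf_of_set (permutations_of_set {..<T})"

abbreviation expect :: "(nat list \<Rightarrow> real) \<Rightarrow> real" where "expect \<equiv> measure_pmf.expectation orders"

abbreviation start :: "nat \<Rightarrow> nat \<Rightarrow> nat" where "start \<equiv> block_start P"

abbreviation leader :: "nat list \<Rightarrow> nat \<Rightarrow> nat" where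
  "leader xs \<equiv> exploration.leader n P k T b (\<lambda>t. c (xs ! t))"

abbreviation mean :: "nat \<Rightarrow> real" where "mean i \<equiv> (\<Sum>x<T. c x i) / card {..<T}"

text \<open>The cost per day of the best expert in hindsight; it enters the analysis only.\<close>

definition best :: real where "best = Min (mean ` {..<n})"

definition incurred :: "nat list \<Rightarrow> nat \<Rightarrow> real" where
  "incurred xs t = c (xs ! t) (exploration.M n P k T b (\<lambda>t. c (xs ! t)) t ! 4)"

lemma exploration: "xs \<in> permutations_of_set {..<T} \<Longrightarrow> exploration n P k T b (\<lambda>t. c (xs ! t))"
  using n P k pools word c nth_mem[of _ xs]
  by unfold_locales (auto simp: permutations_of_setD length_finite_permutations_of_set)

lemma integrable_orders [simp]: "integrable (measure_pmf orders) h" for h :: "nat list \<Rightarrow> real"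
  by (simp add: integrable_measure_pmf_finite)

lemma expect_mono: "(\<And>xs. xs \<in> permutations_of_set {..<T} \<Longrightarrow> g xs \<le> h xs) \<Longrightarrow> expect g \<le> expect h"
  by (rule integral_mono_AE) (simp_all add: AE_measure_pmf_iff)

lemma ln_n: "ln (real n) > 1/2"
proof -
  have "1/2 < ln (2::real)" using ln2_ge_two_thirds by linarith
  also have "\<dots> \<le> ln (real n)" using n by simp
  finally show ?thesis .
qed

definition test_deviation :: "nat \<Rightarrow> nat list \<Rightarrow> nat \<Rightarrow> real" where
  "test_deviation j xs e =
     (\<Sum>t\<in>{start j (e div k)..<start j (e div k) + 2 ^ j}. c (xs ! t) e) - real (2 ^ j) * mean e"

text \<open>The leader's score is at most that of the best expert, so passing between means and test
  sums costs the upward deviation of the best expert and the downward deviation of the leader.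
  Bounding both by maxima over all experts makes it harmless that the leader depends on the
  order.\<close>

lemma leader_mean_le:
  assumes xs: "xs \<in> permutations_of_set {..<T}" and j: "start (Suc j) 0 \<le> T"
  shows "2 ^ j * mean (leader xs (Suc j)) \<le> 2 ^ j * (best + 1 / T) +
    Max ((\<lambda>e. 1 * test_deviation j xs e) ` {..<n}) + Max ((\<lambda>e. - 1 * test_deviation j xs e) ` {..<n})"
proof -
  interpret E: exploration n P k T b "\<lambda>t. c (xs ! t)" by (rule exploration[OF xs])
  have T: "T > 0" using P by linarith
  have "best \<in> mean ` {..<n}"
    unfolding best_def using n by (intro Min_in) (auto simp: lessThan_empty_iff)
  then obtain i where i: "i < n" "best = mean i" by auto
  define ld where "ld = leader xs (Suc j)"
  define S where "S e = (\<Sum>t\<in>{start j (e div k)..<start j (e div k) + 2 ^ j}. c (xs ! t) e)" for e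
  have ld: "ld < n" "E.score j ld \<le> E.score j i"
    using E.leader_phase(2)[of "Suc j" "start (Suc j) 0"] block_start_Suc[of P "Suc j"] P j i
    by (auto simp: E.good_leader_def ld_def)
  have "T * S ld \<le> T * S i + 2 ^ j"
    using E.score_bounds[OF j ld(1)] E.score_bounds[OF j i(1)] ld(2) unfolding S_def by linarith
  then have S: "S ld \<le> S i + 2 ^ j / T" using T by (simp add: field_simps)
  have "1 * test_deviation j xs i \<le> Max ((\<lambda>e. 1 * test_deviation j xs e) ` {..<n})"
    "- 1 * test_deviation j xs ld \<le> Max ((\<lambda>e. - 1 * test_deviation j xs e) ` {..<n})"
    using i ld by (intro Max_ge; simp)+
  then show ?thesis
    using S i(2) unfolding test_deviation_def S_def[symmetric] ld_def[symmetric]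
    by (simp add: distrib_left)
qed

text \<open>\<open>L\<close> may fall short of the whole phase, as the stream may end in the middle
  of it.\<close>

lemma expect_phase_le:
  assumes L: "L \<le> P * 2 ^ j" and fit: "start j 0 + L \<le> T"
  shows "expect (\<lambda>xs. \<Sum>t\<in>{start j 0..<start j 0 + L}. incurred xs t)
    \<le> L * best + 6 * P * sqrt (ln n) * sqrt (2 ^ j)"
proof -
  let ?F = "{start j 0..<start j 0 + L}"
  have T: "T > 0" using P by linarith
  have inc: "incurred xs t = c (xs ! t) (leader xs j)" "leader xs j < n"
    if "xs \<in> permutations_of_set {..<T}" "t \<in> ?F" for xs t
    using exploration.leader_phase[OF exploration[OF that(1)], of j t] that(2) L fit
    by (auto simp: incurred_def block_start_Suc exploration.good_leader_def[OF exploration[OF that(1)]])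
  have best0: "best \<ge> 0"
    unfolding best_def using n c by (intro Min.boundedI) (auto simp: lessThan_empty_iff intro!: divide_nonneg_nonneg sum_nonneg)
  show ?thesis
  proof (cases j)
    \<comment> \<open>Phase \<open>0\<close> follows an untested expert for at most \<open>P\<close>
      days, and \<open>P\<close> is absorbed by the error term.\<close>
    case 0
    have "expect (\<lambda>xs. \<Sum>t\<in>?F. incurred xs t) \<le> expect (\<lambda>xs. real P)"
    proof (rule expect_mono)
      fix xs assume xs: "xs \<in> permutations_of_set {..<T}"
      have "incurred xs t \<le> 1" if "t \<in> ?F" for t
        using exploration.f[OF exploration[OF xs], of t "leader xs j"] inc[OF xs that] fit that by auto
      then have "(\<Sum>t\<in>?F. incurred xs t) \<le> (\<Sum>t\<in>?F. 1)" by (rule sum_mono)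
      then show "(\<Sum>t\<in>?F. incurred xs t) \<le> P" using L 0 by simp
    qed
    also have "\<dots> \<le> 6 * P * sqrt (ln n)"
    proof -
      have "(1/6)\<^sup>2 \<le> ln n" using ln_n by (simp add: power2_eq_square)
      then have "1/6 \<le> sqrt (ln n)" by (rule real_le_rsqrt)
      then show ?thesis using P by (simp add: field_simps)
    qed
    finally show ?thesis using 0 best0 by (simp add: add_increasing)
  next
    case (Suc i)
    define D where "D \<sigma> xs = Max ((\<lambda>e. \<sigma> * test_deviation i xs e) ` {..<n})" for \<sigma> xs
    \<comment> \<open>A maximum over all experts, so it covers the leader although the leader was
      chosen from earlier days of the same permutation.\<close>
    define D' where "D' xs = Max ((\<lambda>e. 1 * ((\<Sum>t\<in>{start j 0..<start j 0 + L}. c (xs ! t) e) - real L * mean e)) ` {..<n})" for xs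
    have blocks: "start i (e div k) + 2 ^ i \<le> T" if "e < n" for e
    proof -
      have "e div k < P" using pools k that by (simp add: less_mult_imp_div_less mult.commute)
      from block_end_le[OF this, of i] show ?thesis using fit unfolding Suc by linarith
    qed
    have ED: "expect (D \<sigma>) \<le> sqrt (real (2 ^ i) * ln n)" if "\<sigma> \<in> {-1, 1}" for \<sigma>
      unfolding D_def test_deviation_def
      by (intro expectation_Max_block_deviation_le) (use n blocks c that in auto)
    have ED': "expect D' \<le> sqrt (real L * ln n)"
      unfolding D'_def by (intro expectation_Max_block_deviation_le) (use n fit c in auto)
    have "expect (\<lambda>xs. \<Sum>t\<in>?F. incurred xs t) \<le>
        expect (\<lambda>xs. L * (best + 1 / T) + L / 2 ^ i * (D 1 xs + D (- 1) xs) + D' xs)"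
    proof (rule expect_mono)
      fix xs assume xs: "xs \<in> permutations_of_set {..<T}"
      show "(\<Sum>t\<in>?F. incurred xs t) \<le> L * (best + 1 / T) + L / 2 ^ i * (D 1 xs + D (- 1) xs) + D' xs"
      proof (cases "L = 0")
        \<comment> \<open>Without a day in \<open>?F\<close>, \<open>inc\<close> does not yield that
          the leader is an expert.\<close>
        case True
        then show ?thesis using n by (simp add: D'_def lessThan_empty_iff)
      next
        case False
        let ?ld = "leader xs j"
        have ld: "?ld < n" using inc(2)[OF xs, of "start j 0"] False by simp
        have "(\<Sum>t\<in>?F. incurred xs t) = (\<Sum>t\<in>?F. c (xs ! t) ?ld)"
          using inc(1)[OF xs] by (intro sum.cong) auto
        also have "\<dots> \<le> L * mean ?ld + D' xs"
        proof -
          have "1 * ((\<Sum>t\<in>?F. c (xs ! t) ?ld) - real L * mean ?ld) \<le> D' xs"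
            unfolding D'_def using ld by (intro Max_ge) auto
          then show ?thesis by (simp only: mult_1 diff_le_eq add.commute)
        qed
        also have "L * mean ?ld \<le> L * (best + 1 / T) + L / 2 ^ i * (D 1 xs + D (- 1) xs)"
        proof -
          have "2 ^ i * mean ?ld \<le> 2 ^ i * (best + 1 / T) + D 1 xs + D (- 1) xs"
            using leader_mean_le[OF xs, of i] fit Suc by (simp add: D_def)
          then have "L / 2 ^ i * (2 ^ i * mean ?ld) \<le> L / 2 ^ i * (2 ^ i * (best + 1 / T) + D 1 xs + D (- 1) xs)"
            by (rule mult_left_mono) simp
          then show ?thesis by (simp add: algebra_simps add_divide_distrib)
        qed
        finally show ?thesis by simp
      qed
    qed
    also have "\<dots> = L * (best + 1 / T) + L / 2 ^ i * (expect (D 1) + expect (D (- 1))) + expect D'"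
      by simp
    also have "\<dots> \<le> L * (best + 1 / T) + (2 * P) * (sqrt (real (2 ^ i) * ln n) + sqrt (real (2 ^ i) * ln n)) + sqrt (real L * ln n)"
    proof -
      have "real L \<le> real (P * 2 ^ j)" using L by (rule of_nat_mono)
      then have "L / 2 ^ i \<le> 2 * P" using Suc by (simp add: field_simps)
      then show ?thesis
        using ED[of 1] ED[of "-1"] ED' ln_n
        by (intro add_mono order_refl order_trans[OF mult_left_mono mult_right_mono]) auto
    qed
    \<comment> \<open>In units of \<open>P * R\<close>, the constant \<open>6\<close> consists of
      \<open>4\<close> for the two test deviations scaled by \<open>L / 2 ^ i \<le> 2 * P\<close>,
      \<open>1\<close> for the deviation during the phase itself and \<open>1\<close> for
      rounding.\<close>
    also have "\<dots> \<le> L * best + 6 * P * sqrt (ln n) * sqrt (2 ^ j)"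
    proof -
      define R where "R = sqrt (ln n) * sqrt (2 ^ j)"
      have "1\<^sup>2 \<le> ln n * 2 ^ j"
        using mult_mono[of "1/2" "ln n" 2 "2 ^ j"] ln_n Suc by simp
      then have R: "1 \<le> R" unfolding R_def real_sqrt_mult[symmetric] by (rule real_le_rsqrt)
      have "sqrt (real (2 ^ i) * ln n) \<le> R"
        unfolding R_def real_sqrt_mult[symmetric] real_sqrt_le_iff using ln_n Suc by simp
      moreover have "sqrt (real L * ln n) \<le> P * R"
      proof -
        have "real L * ln n \<le> (real P * 2 ^ j) * ln n"
          using L ln_n of_nat_mono[OF L, where 'a = real] by (intro mult_right_mono) auto
        also have "\<dots> \<le> (real P)\<^sup>2 * (ln n * 2 ^ j)"
          using P ln_n by (simp add: power2_eq_square)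
        finally have "sqrt (real L * ln n) \<le> sqrt ((real P)\<^sup>2 * (ln n * 2 ^ j))" by simp
        then show ?thesis by (simp add: R_def real_sqrt_mult)
      qed
      moreover have "L * (1 / real T) \<le> P * R"
      proof -
        have "L * (1 / real T) \<le> 1" using fit T by (simp add: field_simps)
        also have "1 \<le> real P * R" using P R mult_mono[of 1 "real P" 1 R] by simp
        finally show ?thesis .
      qed
      moreover have "(2 * P) * (sqrt (real (2 ^ i) * ln n) + sqrt (real (2 ^ i) * ln n)) \<le> 4 * (P * R)"
        using calculation(1) mult_left_mono[OF calculation(1), of "4 * real P"] by simp
      ultimately have "L * (best + 1 / T) + (2 * P) * (sqrt (real (2 ^ i) * ln n) + sqrt (real (2 ^ i) * ln n)) + sqrt (real L * ln n)
          \<le> L * best + 6 * (P * R)"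
        by (simp add: distrib_left)
      then show ?thesis by (simp add: R_def mult.assoc)
    qed
    finally show ?thesis .
  qed
qed

text \<open>The errors of the phases form a geometric series of ratio \<open>sqrt 2\<close>. The
  induction closes because \<open>18 + 6 \<le> 18 * sqrt 2\<close>, a consequence of
  \<open>4/3 \<le> sqrt 2\<close>. The prefix need not end with a phase.\<close>

lemma expect_prefix_le:
  assumes "m \<le> T" "m \<le> start j 0"
  shows "expect (\<lambda>xs. \<Sum>t<m. incurred xs t) \<le> m * best + 18 * P * sqrt (ln n) * sqrt (2 ^ j)"
  using assms
proof (induction j arbitrary: m)
  case 0
  then have "m = 0" by (simp add: block_start_def)
  then show ?case using ln_n by simp
next
  case (Suc j)
  define R where "R = P * sqrt (ln n) * sqrt (2 ^ j)"
  have "R \<ge> 0" using ln_n by (simp add: R_def)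
  have "(4/3)\<^sup>2 \<le> (2::real)" by (simp add: power2_eq_square)
  then have "4/3 \<le> sqrt 2" by (rule real_le_rsqrt)
  then have "R * (4/3) \<le> R * sqrt 2" using \<open>R \<ge> 0\<close> by (rule mult_left_mono)
  then have R: "24 * R \<le> 18 * P * sqrt (ln n) * sqrt (2 ^ Suc j)"
    by (simp add: R_def real_sqrt_mult mult_ac)
  show ?case
  proof (cases "m \<le> start j 0")
    case True
    with Suc have "expect (\<lambda>xs. \<Sum>t<m. incurred xs t) \<le> m * best + 18 * R"
      by (simp add: R_def mult.assoc)
    with R \<open>R \<ge> 0\<close> show ?thesis by linarith
  next
    case False
    define L where "L = m - start j 0"
    have m: "m = start j 0 + L" "L \<le> P * 2 ^ j"
      using False Suc.prems block_start_Suc[of P j] by (auto simp: L_def)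
    have "expect (\<lambda>xs. \<Sum>t<m. incurred xs t) =
        expect (\<lambda>xs. \<Sum>t<start j 0. incurred xs t) + expect (\<lambda>xs. \<Sum>t\<in>{start j 0..<start j 0 + L}. incurred xs t)"
      using sum.atLeastLessThan_concat[of 0 "start j 0" m "\<lambda>t. expect (\<lambda>xs. incurred xs t)"]
      by (simp add: m atLeast0LessThan)
    also have "\<dots> \<le> (start j 0 * best + 18 * R) + (L * best + 6 * R)"
      using Suc.IH[of "start j 0"] expect_phase_le[OF m(2)] m(1) Suc.prems(1)
      by (intro add_mono) (auto simp: R_def mult.assoc)
    also have "\<dots> = m * best + 24 * R" by (simp add: m distrib_right)
    finally show ?thesis using R by linarith
  qed
qed

lemma expect_total_le: "expect (\<lambda>xs. \<Sum>t<T. incurred xs t) \<le> T * best + 36 * sqrt (real P * real T * ln n)"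
proof -
  have T: "T > 0" using P by linarith
  have start: "start j 0 = P * (2 ^ j - 1)" for j by (simp add: block_start_def)
  \<comment> \<open>The number of phases that exhausts the stream.\<close>
  define j where "j = (LEAST j. T \<le> start j 0)"
  have "T < 2 ^ T" by (rule less_exp)
  then have "T \<le> 2 ^ T - 1" by linarith
  then have "1 * T \<le> P * (2 ^ T - 1)" using P by (intro mult_le_mono) auto
  then have j: "T \<le> start j 0"
    unfolding j_def by (intro LeastI[of "\<lambda>j. T \<le> start j 0" T]) (simp add: start)
  then obtain i where i: "j = Suc i" using T by (cases j) (auto simp: start)
  then have "start i 0 < T"
    using not_less_Least[of i "\<lambda>j. T \<le> start j 0"] j_def by auto
  \<comment> \<open>With \<open>P \<le> T\<close> this gives \<open>P * 2 ^ i < 2 * T\<close>, so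
    the last phase is not much longer than the stream.\<close>
  then have "P * 2 ^ i - P < T" by (simp add: start diff_mult_distrib2)
  then have "P * 2 ^ j \<le> 4 * T" using P i by simp
  then have PT: "real P * 2 ^ j \<le> 4 * real T" using of_nat_mono[where 'a = real] by fastforce
  have "P * sqrt (ln n) * sqrt (2 ^ j) = sqrt ((real P * ln n) * (real P * 2 ^ j))"
    by (simp add: real_sqrt_mult)
  also have "\<dots> \<le> sqrt ((real P * ln n) * (4 * real T))"
    using PT ln_n by (intro real_sqrt_le_mono mult_left_mono) auto
  also have "\<dots> = 2 * sqrt (real P * real T * ln n)"
    by (simp add: real_sqrt_mult)
  finally show ?thesis
    using expect_prefix_le[OF order_refl j] by simp
qed

end

section \<open>Hedge\<close>

fun hedge_step :: "nat \<Rightarrow> nat \<Rightarrow> memory \<Rightarrow> real \<Rightarrow> memory" where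
  "hedge_step n N (i # cs) r = (if i + 1 < n then i + 1 else 0) # cs[i := cs ! i + nat \<lfloor>r * real N\<rfloor>]"
| "hedge_step n N [] r = []"

definition hedge_weight :: "real \<Rightarrow> nat \<Rightarrow> memory \<Rightarrow> nat \<Rightarrow> real" where
  "hedge_weight \<eta> N m i = exp (- \<eta> * (real (m ! Suc i) / real N))"

text \<open>Only rounded cumulative costs are stored; the real weights are recomputed from them
  every day.\<close>

definition hedge_pick :: "nat \<Rightarrow> real \<Rightarrow> nat \<Rightarrow> memory \<Rightarrow> nat pmf" where
  "hedge_pick n \<eta> N m =
     embed_pmf (\<lambda>i. if i < n then hedge_weight \<eta> N m i / (\<Sum>i<n. hedge_weight \<eta> N m i) else 0)"

lemma hedge_weight_sum_pos: "n > 0 \<Longrightarrow> (\<Sum>i<n. hedge_weight \<eta> N m i) > 0"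
  by (intro sum_pos) (auto simp: hedge_weight_def lessThan_empty_iff)

lemma pmf_hedge_pick:
  assumes "n > 0"
  shows "pmf (hedge_pick n \<eta> N m) i =
    (if i < n then hedge_weight \<eta> N m i / (\<Sum>i<n. hedge_weight \<eta> N m i) else 0)"
  unfolding hedge_pick_def
proof (rule pmf_embed_pmf)
  let ?q = "\<lambda>i. if i < n then hedge_weight \<eta> N m i / (\<Sum>i<n. hedge_weight \<eta> N m i) else 0"
  show nonneg: "?q i \<ge> 0" for i
    using hedge_weight_sum_pos[OF assms, of \<eta> N m] by (simp add: hedge_weight_def)
  have "(\<integral>\<^sup>+ i. ennreal (?q i) \<partial>count_space UNIV) = (\<Sum>i<n. ennreal (?q i))"
    by (rule nn_integral_count_space') auto
  also have "\<dots> = ennreal (\<Sum>i<n. ?q i)"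
    by (rule sum_ennreal) (rule nonneg)
  also have "(\<Sum>i<n. ?q i) = 1"
    using hedge_weight_sum_pos[OF assms, of \<eta> N m] by (simp flip: sum_divide_distrib)
  finally show "(\<integral>\<^sup>+ i. ennreal (?q i) \<partial>count_space UNIV) = 1" by simp
qed

lemma set_hedge_pick: "n > 0 \<Longrightarrow> set_pmf (hedge_pick n \<eta> N m) \<subseteq> {..<n}"
  by (auto simp: set_pmf_eq pmf_hedge_pick split: if_splits)

lemma expectation_hedge_pick:
  assumes "n > 0"
  shows "measure_pmf.expectation (hedge_pick n \<eta> N m) g =
    (\<Sum>i<n. hedge_weight \<eta> N m i * g i) / (\<Sum>i<n. hedge_weight \<eta> N m i)"
  using set_hedge_pick[OF assms]
  by (subst integral_measure_pmf_real[of "{..<n}"])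
    (auto simp: pmf_hedge_pick[OF assms] sum_divide_distrib mult.commute)

text \<open>The third-order Lagrange remainder is nonpositive.\<close>

lemma exp_minus_le_quadratic:
  assumes "(x::real) \<ge> 0"
  shows "exp (- x) \<le> 1 - x + x\<^sup>2 / 2"
proof (cases "x = 0")
  case False
  then have "- x < 0" using assms by simp
  obtain t where "exp (- x) = (\<Sum>m<3. (- x) ^ m / fact m) + exp t / fact 3 * (- x) ^ 3" 
    using Maclaurin_exp_le[of "-x" 3] by auto
  moreover have "exp t / fact 3 * (- x) ^ 3 \<le> 0"
    using assms by (intro mult_nonneg_nonpos) (auto simp: power3_eq_cube mult_nonpos_nonneg)
  moreover have "(\<Sum>m<3. (- x) ^ m / fact m) = 1 - x + x\<^sup>2 / 2"
    by (simp add: numeral_3_eq_3 power2_eq_square)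
  ultimately show ?thesis by linarith
qed simp

locale hedge =
  fixes n T b :: nat and \<eta> :: real and f :: "nat \<Rightarrow> nat \<Rightarrow> real"
  assumes n: "n > 0" and T: "T > 0" and \<eta>: "\<eta> > 0"
    and word: "n < 2 ^ b" "T * T < 2 ^ b"
    and f: "\<And>t i. t < T \<Longrightarrow> i < n \<Longrightarrow> f t i \<in> {0..1}"
begin

definition w :: "nat \<Rightarrow> nat \<Rightarrow> nat" where "w t i = nat \<lfloor>f t i * real T\<rfloor>"

definition step :: "memory \<Rightarrow> real \<Rightarrow> memory" where
  "step = guarded (1 + n) b (hedge_step n T)"

definition M :: "nat \<Rightarrow> memory" where "M t = table_after step (replicate (1 + n) 0) n f t"

text \<open>The intended counter of expert \<open>e\<close> on day \<open>t\<close> once the costs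
  of the experts below \<open>i\<close> have been read.\<close>

definition partial_cost :: "nat \<Rightarrow> nat \<Rightarrow> nat \<Rightarrow> nat" where
  "partial_cost t i e = (\<Sum>s<t + (if e < i then 1 else 0). w s e)"

lemma w_bounds:
  assumes "t < T" "i < n"
  shows "w t i \<le> T" "w t i \<le> T * f t i" "T * f t i \<le> w t i + 1"
proof -
  have *: "f t i * real T \<le> 1 * real T" "f t i * real T \<ge> 0"
    using f[OF assms] by (intro mult_right_mono mult_nonneg_nonneg; simp)+
  then have "of_nat (w t i) = real_of_int \<lfloor>f t i * real T\<rfloor>" by (simp add: w_def)
  then show "w t i \<le> T * f t i" "T * f t i \<le> w t i + 1"
    unfolding mult.commute[of "real T"] by linarith+
  have "\<lfloor>f t i * real T\<rfloor> \<le> int T" using * by linarith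
  then show "w t i \<le> T" by (simp add: w_def)
qed

text \<open>The closed form bounds every counter by \<open>T * T\<close>, so the guard never
  intervenes.\<close>

lemma memory_within_day:
  assumes t: "t < T" and M: "M t = 0 # map (partial_cost t 0) [0..<n]" and i: "i \<le> n"
  shows "foldl step (M t) (map (f t) [0..<i]) = (if i < n then i else 0) # map (partial_cost t i) [0..<n]"
  using i
proof (induction i)
  case (Suc i)
  have "(map (partial_cost t i) [0..<n])[i := partial_cost t i i + w t i] = map (partial_cost t (Suc i)) [0..<n]"
    using Suc.prems by (intro nth_equalityI) (auto simp: nth_list_update partial_cost_def)
  then have eq: "hedge_step n T (i # map (partial_cost t i) [0..<n]) (f t i) =
      (if Suc i < n then Suc i else 0) # map (partial_cost t (Suc i)) [0..<n]"
    using Suc.prems by (simp add: w_def)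
  have "partial_cost t (Suc i) e < 2 ^ b" if "e < n" for e
  proof -
    have "partial_cost t (Suc i) e \<le> (\<Sum>s<t + (if e < Suc i then 1 else 0). T)"
      unfolding partial_cost_def using t that by (intro sum_mono w_bounds) (auto split: if_splits)
    also have "\<dots> \<le> T * T" using t by simp
    finally show ?thesis using word by linarith
  qed
  then have "hedge_step n T (i # map (partial_cost t i) [0..<n]) (f t i) \<in> memories (1 + n) b"
    unfolding eq memories_def using Suc.prems word(1) by auto
  then show ?case
    using Suc eq by (simp add: step_def guarded_def)
qed (use M n in simp)

lemma memory_at: "t \<le> T \<Longrightarrow> M t = 0 # map (partial_cost t 0) [0..<n]"
proof (induction t)
  case 0
  show ?case
    by (simp add: M_def partial_cost_def map_replicate_const)
next
  case (Suc t)
  have "M (Suc t) = foldl step (M t) (map (f t) [0..<n])"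
    by (simp add: M_def table_after_Suc)
  also have "\<dots> = 0 # map (partial_cost t n) [0..<n]"
    using memory_within_day[of t n] Suc by simp
  also have "map (partial_cost t n) [0..<n] = map (partial_cost (Suc t) 0) [0..<n]"
    by (auto simp: partial_cost_def)
  finally show ?case .
qed

abbreviation W :: "nat \<Rightarrow> real" where "W t \<equiv> (\<Sum>i<n. hedge_weight \<eta> T (M t) i)"

text \<open>Taken with respect to the rounded costs, since these are what the weights react to; the
  true costs return in \<open>cost_le\<close>.\<close>

abbreviation loss :: "nat \<Rightarrow> real" where
  "loss t \<equiv> measure_pmf.expectation (hedge_pick n \<eta> T (M t)) (\<lambda>i. w t i / T)"

lemma hedge_weight_M: "t \<le> T \<Longrightarrow> i < n \<Longrightarrow> hedge_weight \<eta> T (M t) i = exp (- \<eta> * ((\<Sum>s<t. w s i) / T))"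
  by (simp add: memory_at hedge_weight_def partial_cost_def)

text \<open>The usual potential step: expand the exponential to second order, use that rounded costs
  are at most \<open>1\<close>, and return to an exponential by
  \<open>1 + x \<le> exp x\<close>.\<close>

lemma W_Suc_le:
  assumes t: "t < T"
  shows "W (Suc t) \<le> W t * exp (- \<eta> * loss t + \<eta>\<^sup>2 / 2)"
proof -
  have pos: "W t > 0" using hedge_weight_sum_pos[OF n] .
  have "W (Suc t) = (\<Sum>i<n. hedge_weight \<eta> T (M t) i * exp (- (\<eta> * (w t i / T))))"
    using t by (intro sum.cong) (auto simp: hedge_weight_M distrib_left add_divide_distrib simp flip: exp_add)
  also have "\<dots> \<le> (\<Sum>i<n. hedge_weight \<eta> T (M t) i * (1 - \<eta> * (w t i / T) + \<eta>\<^sup>2 / 2))"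
  proof (intro sum_mono mult_left_mono)
    fix i assume i: "i \<in> {..<n}"
    define x where "x = real (w t i) / T"
    have x: "0 \<le> x" "x \<le> 1" using w_bounds(1)[OF t, of i] i T by (auto simp: x_def)
    have "exp (- (\<eta> * x)) \<le> 1 - \<eta> * x + (\<eta> * x)\<^sup>2 / 2"
      using x \<eta> by (intro exp_minus_le_quadratic) simp
    also have "(\<eta> * x)\<^sup>2 \<le> \<eta>\<^sup>2"
      using x \<eta> by (simp add: power_mult_distrib mult_left_le power_le_one)
    finally show "exp (- (\<eta> * (w t i / T))) \<le> 1 - \<eta> * (w t i / T) + \<eta>\<^sup>2 / 2"
      by (simp add: x_def)
  qed (simp add: hedge_weight_def)
  also have "\<dots> = W t * (1 + \<eta>\<^sup>2 / 2) - \<eta> * (\<Sum>i<n. hedge_weight \<eta> T (M t) i * (w t i / T))"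
  proof -
    have "h * (1 - \<eta> * x + \<eta>\<^sup>2 / 2) = h * (1 + \<eta>\<^sup>2 / 2) - \<eta> * (h * x)" for h x
      by (simp add: algebra_simps)
    then show ?thesis by (simp only: sum_subtractf flip: sum_distrib_right sum_distrib_left)
  qed
  also have "(\<Sum>i<n. hedge_weight \<eta> T (M t) i * (w t i / T)) = W t * loss t"
  proof -
    have "a = W t * (a / W t)" for a using pos by simp
    then show ?thesis by (simp only: expectation_hedge_pick[OF n])
  qed
  also have "W t * (1 + \<eta>\<^sup>2 / 2) - \<eta> * (W t * loss t) = W t * (1 + (- \<eta> * loss t + \<eta>\<^sup>2 / 2))"
    by (simp add: algebra_simps)
  also have "\<dots> \<le> W t * exp (- \<eta> * loss t + \<eta>\<^sup>2 / 2)"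
    using pos by (intro mult_left_mono exp_ge_add_one_self) simp
  finally show ?thesis .
qed

lemma W_le: "t \<le> T \<Longrightarrow> W t \<le> n * exp (- \<eta> * (\<Sum>s<t. loss s) + t * \<eta>\<^sup>2 / 2)"
proof (induction t)
  case 0
  show ?case using hedge_weight_M[of 0] by simp
next
  case (Suc t)
  have "W (Suc t) \<le> W t * exp (- \<eta> * loss t + \<eta>\<^sup>2 / 2)"
    using Suc by (intro W_Suc_le) simp
  also have "\<dots> \<le> n * exp (- \<eta> * (\<Sum>s<t. loss s) + t * \<eta>\<^sup>2 / 2) * exp (- \<eta> * loss t + \<eta>\<^sup>2 / 2)"
    using Suc by (intro mult_right_mono) auto
  also have "\<dots> = n * exp (- \<eta> * (\<Sum>s<Suc t. loss s) + Suc t * \<eta>\<^sup>2 / 2)"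
  proof -
    have "- \<eta> * S + t * \<eta>\<^sup>2 / 2 + (- \<eta> * x + \<eta>\<^sup>2 / 2) = - \<eta> * (S + x) + Suc t * \<eta>\<^sup>2 / 2" for S x
      by (simp add: field_simps)
    then show ?thesis by (simp only: mult.assoc sum.lessThan_Suc flip: exp_add)
  qed
  finally show ?case .
qed

text \<open>A single weight bounds the total weight from below; comparing logarithms with
  \<open>W_le\<close> bounds the rounded loss. Undoing the rounding adds at most
  \<open>1 / T\<close> per day.\<close>

lemma cost_le:
  assumes i: "i < n"
  shows "(\<Sum>t<T. measure_pmf.expectation (hedge_pick n \<eta> T (M t)) (f t)) \<le>
    (\<Sum>t<T. f t i) + ln n / \<eta> + T * \<eta> / 2 + 1"
proof -
  have fin: "finite (set_pmf (hedge_pick n \<eta> T m))" for m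
    by (rule finite_subset[OF set_hedge_pick[OF n]]) simp
  have "hedge_weight \<eta> T (M T) i \<le> W T"
    using i by (intro member_le_sum) (auto simp: hedge_weight_def)
  also have "\<dots> \<le> n * exp (- \<eta> * (\<Sum>t<T. loss t) + T * \<eta>\<^sup>2 / 2)"
    by (rule W_le) simp
  finally have "ln (hedge_weight \<eta> T (M T) i) \<le> ln (n * exp (- \<eta> * (\<Sum>t<T. loss t) + T * \<eta>\<^sup>2 / 2))"
    using n by (subst ln_le_cancel_iff) (auto simp: hedge_weight_def)
  moreover define R where "R = (\<Sum>t<T. loss t)"
  moreover define S where "S = real (\<Sum>t<T. w t i) / T"
  ultimately have "- \<eta> * S \<le> ln n - \<eta> * R + T * \<eta>\<^sup>2 / 2"
    using n i by (simp add: hedge_weight_M ln_mult)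
  then have "\<eta> * R \<le> \<eta> * (S + ln n / \<eta> + T * \<eta> / 2)"
    using \<eta> by (simp add: distrib_left power2_eq_square mult.left_commute)
  then have "R \<le> S + ln n / \<eta> + T * \<eta> / 2"
    using \<eta> by simp
  moreover have "S \<le> (\<Sum>t<T. f t i)"
  proof -
    have "w t i / T \<le> f t i" if "t < T" for t
      using w_bounds(2)[OF that i] T by (simp add: divide_le_eq mult.commute)
    then show ?thesis
      unfolding S_def of_nat_sum sum_divide_distrib by (intro sum_mono) simp
  qed
  moreover have "(\<Sum>t<T. measure_pmf.expectation (hedge_pick n \<eta> T (M t)) (f t)) \<le> (\<Sum>t<T. loss t + 1 / T)"
  proof (rule sum_mono)
    fix t assume t: "t \<in> {..<T}"
    have "measure_pmf.expectation (hedge_pick n \<eta> T (M t)) (f t) \<le>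
        measure_pmf.expectation (hedge_pick n \<eta> T (M t)) (\<lambda>i. w t i / T + 1 / T)"
    proof (rule integral_mono_AE)
      have "f t i \<le> w t i / T + 1 / T" if "i < n" for i
        using w_bounds(3)[of t i] t that T by (simp add: field_simps)
      then show "AE i in measure_pmf (hedge_pick n \<eta> T (M t)). f t i \<le> w t i / T + 1 / T"
        using set_hedge_pick[OF n, of \<eta> T "M t"] by (auto simp: AE_measure_pmf_iff)
    qed (use fin in \<open>auto intro: integrable_measure_pmf_finite\<close>)
    also have "\<dots> = loss t + 1 / T"
      using fin by (simp add: integrable_measure_pmf_finite)
    finally show "measure_pmf.expectation (hedge_pick n \<eta> T (M t)) (f t) \<le> loss t + 1 / T" .
  qed
  moreover have "(\<Sum>t<T. loss t + 1 / T) = R + 1"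
    using T by (simp only: R_def sum.distrib) simp
  ultimately show ?thesis by linarith
qed

end

section \<open>Choice of the algorithm\<close>

lemma guarded_memories: "m \<in> memories s b \<Longrightarrow> guarded s b g m r \<in> memories s b"
  by (simp add: guarded_def)

lemma sum_permutation_of_lessThan:
  assumes "xs \<in> permutations_of_set {..<T}"
  shows "(\<Sum>t<T. g (xs ! t)) = (\<Sum>t<T. g t)"
proof -
  have "(\<Sum>t<T. g (xs ! t)) = sum_list (map g xs)"
    using assms by (simp add: sum_list_sum_nth length_finite_permutations_of_set atLeast0LessThan)
  also have "\<dots> = (\<Sum>t<T. g t)"
    using assms by (metis permutations_of_setD sum.distinct_set_conv_list)
  finally show ?thesis .
qed

text \<open>With costs in \<open>{0..1}\<close> the regret never exceeds \<open>1\<close>, and a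
  single expert has none. Zero words of zero bits are used because the word length allowed for
  \<open>n = T = 1\<close> is \<open>0\<close>.\<close>

lemma constant_algorithm:
  assumes n: "n \<ge> 1" and T: "T \<ge> 1" and \<delta>: "\<delta> \<ge> 0" "n = 1 \<or> \<delta> \<ge> 1"
  shows "\<exists>A :: 'p expert_algorithm. streaming_algorithm A n 0 0 \<and>
    (\<forall>(x :: nat \<Rightarrow> nat \<Rightarrow> 'p) (c :: nat \<Rightarrow> nat \<Rightarrow> real). (\<forall>t<T. \<forall>i<n. c t i \<in> {0..1}) \<longrightarrow>
      expected_regret_random_order A n T (\<lambda>t. (x t, c t)) \<le> \<delta>)"
proof (intro exI conjI allI impI)
  let ?A = "table_algorithm [] (\<lambda>m r. []) (\<lambda>_. return_pmf 0) :: 'p expert_algorithm"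
  show "streaming_algorithm ?A n 0 0"
    using n by (intro streaming_table_algorithm) (auto simp: memories_def)
  fix x :: "nat \<Rightarrow> nat \<Rightarrow> 'p" and c :: "nat \<Rightarrow> nat \<Rightarrow> real"
  assume c: "\<forall>t<T. \<forall>i<n. c t i \<in> {0..1}"
  let ?B = "Min ((\<lambda>i. \<Sum>t<T. c t i) ` {..<n})"
  have "measure_pmf.expectation (pmf_of_set (permutations_of_set {..<T})) (\<lambda>xs. \<Sum>t<T. c (xs ! t) 0) =
      measure_pmf.expectation (pmf_of_set (permutations_of_set {..<T})) (\<lambda>xs. \<Sum>t<T. c t 0)"
    by (rule integral_cong_AE) (simp_all add: AE_measure_pmf_iff sum_permutation_of_lessThan[where g = "\<lambda>t. c t 0"])
  then have eq: "expected_regret_random_order ?A n T (\<lambda>t. (x t, c t)) = ((\<Sum>t<T. c t 0) - ?B) / T"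
    by (simp add: expected_regret_table_algorithm)
  have "(\<Sum>t<T. c t 0) - ?B \<le> \<delta> * T"
    using \<delta>(2)
  proof
    assume "n = 1"
    then show ?thesis using \<delta> by (simp add: lessThan_Suc)
  next
    assume "\<delta> \<ge> 1"
    have "?B \<ge> 0"
      using n c by (intro Min.boundedI) (auto simp: lessThan_empty_iff intro!: sum_nonneg)
    moreover have "(\<Sum>t<T. c t 0) \<le> (\<Sum>t<T. 1)"
      using c n by (intro sum_mono) auto
    moreover have "1 * real T \<le> \<delta> * T" using \<open>\<delta> \<ge> 1\<close> by (intro mult_right_mono) auto
    ultimately show ?thesis by simp
  qed
  then show "expected_regret_random_order ?A n T (\<lambda>t. (x t, c t)) \<le> \<delta>"
    unfolding eq using T by (simp add: divide_le_eq)
qed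

lemma hedge_algorithm:
  assumes n: "n \<ge> 2" and T: "T \<ge> 1" and word: "n < 2 ^ b" "T * T < 2 ^ b"
    and \<delta>: "sqrt (2 * real T * ln n) + 1 \<le> \<delta> * T"
  shows "\<exists>A :: 'p expert_algorithm. streaming_algorithm A n (1 + n) b \<and>
    (\<forall>(x :: nat \<Rightarrow> nat \<Rightarrow> 'p) (c :: nat \<Rightarrow> nat \<Rightarrow> real). (\<forall>t<T. \<forall>i<n. c t i \<in> {0..1}) \<longrightarrow>
      expected_regret_random_order A n T (\<lambda>t. (x t, c t)) \<le> \<delta>)"
proof (intro exI conjI allI impI)
  \<comment> \<open>The minimiser of \<open>ln n / \<eta> + T * \<eta> / 2\<close>.\<close>
  define \<eta> where "\<eta> = sqrt (2 * ln n / T)"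
  let ?step = "guarded (1 + n) b (hedge_step n T)"
  let ?A = "table_algorithm (replicate (1 + n) 0) ?step (hedge_pick n \<eta> T) :: 'p expert_algorithm"
  have fin: "finite (set_pmf (hedge_pick n \<eta> T m))" for m
    by (rule finite_subset[OF set_hedge_pick]) (use n in simp_all)
  show "streaming_algorithm ?A n (1 + n) b"
    using n set_hedge_pick[of n]
    by (intro streaming_table_algorithm guarded_memories) (auto simp: memories_def)
  have pos: "ln (real n) > 0" "real T > 0" using n T by simp_all
  then have \<eta>: "\<eta> > 0" by (simp add: \<eta>_def)
  have \<eta>_bound: "ln n / \<eta> + T * \<eta> / 2 = sqrt (2 * real T * ln n)"
  proof -
    have "sqrt (2 * real T * ln n) * \<eta> = sqrt ((2 * ln n)\<^sup>2)"
      using pos by (simp add: \<eta>_def power2_eq_square flip: real_sqrt_mult)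
    also have "\<dots> = 2 * ln n" using pos by (subst real_sqrt_abs) simp
    finally have "sqrt (2 * real T * ln n) * \<eta> = 2 * ln n" .
    moreover have "T * \<eta>\<^sup>2 = 2 * ln n"
      using pos by (simp add: \<eta>_def)
    ultimately have "ln n / \<eta> + T * \<eta> / 2 = (sqrt (2 * real T * ln n) * \<eta>) / \<eta>"
      using \<eta> pos by (simp add: field_simps power2_eq_square)
    then show ?thesis using \<eta> by simp
  qed
  fix x :: "nat \<Rightarrow> nat \<Rightarrow> 'p" and c :: "nat \<Rightarrow> nat \<Rightarrow> real"
  assume c: "\<forall>t<T. \<forall>i<n. c t i \<in> {0..1}"
  define B where "B = Min ((\<lambda>i. \<Sum>t<T. c t i) ` {..<n})"
  let ?cost = "\<lambda>xs. \<Sum>t<T. measure_pmf.expectation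
      (hedge_pick n \<eta> T (table_after ?step (replicate (1 + n) 0) n (\<lambda>t. c (xs ! t)) t)) (c (xs ! t))"
  have "measure_pmf.expectation (pmf_of_set (permutations_of_set {..<T})) ?cost \<le>
      measure_pmf.expectation (pmf_of_set (permutations_of_set {..<T})) (\<lambda>_. B + \<delta> * T)"
  proof (rule integral_mono_AE)
    \<comment> \<open>Hedge meets the bound on every order, hence on average.\<close>
    have "?cost xs \<le> B + \<delta> * T" if xs: "xs \<in> permutations_of_set {..<T}" for xs
    proof -
      have "xs ! t < T" if "t < T" for t
        using xs that nth_mem[of t xs] by (auto simp: permutations_of_setD length_finite_permutations_of_set)
      then interpret hedge n T b \<eta> "\<lambda>t. c (xs ! t)"
        using n T \<eta> word c by unfold_locales auto
      have "B \<in> (\<lambda>i. \<Sum>t<T. c t i) ` {..<n}"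
        unfolding B_def using n by (intro Min_in) (auto simp: lessThan_empty_iff)
      then obtain i where i: "i < n" "B = (\<Sum>t<T. c t i)" by auto
      have "?cost xs = (\<Sum>t<T. measure_pmf.expectation (hedge_pick n \<eta> T (M t)) (c (xs ! t)))"
        by (simp add: M_def step_def)
      also have "\<dots> \<le> (\<Sum>t<T. c (xs ! t) i) + ln n / \<eta> + T * \<eta> / 2 + 1"
        by (rule cost_le[OF i(1)])
      also have "(\<Sum>t<T. c (xs ! t) i) = B"
        unfolding i(2) by (rule sum_permutation_of_lessThan[OF xs, where g = "\<lambda>t. c t i"])
      finally show ?thesis using \<eta>_bound \<delta> by simp
    qed
    then show "AE xs in measure_pmf (pmf_of_set (permutations_of_set {..<T})). ?cost xs \<le> B + \<delta> * T"
      by (simp add: AE_measure_pmf_iff)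
  qed (simp_all add: integrable_measure_pmf_finite)
  then have "measure_pmf.expectation (pmf_of_set (permutations_of_set {..<T})) ?cost - B \<le> \<delta> * T"
    by simp
  then show "expected_regret_random_order ?A n T (\<lambda>t. (x t, c t)) \<le> \<delta>"
    unfolding expected_regret_table_algorithm[OF fin] B_def[symmetric] using T by (simp add: divide_le_eq)
qed

lemma exploration_algorithm:
  fixes n P k T b :: nat and \<delta> :: real
  assumes n: "n \<ge> 2" and P: "P > 0" "P \<le> T" and k: "k > 0" and pools: "n \<le> k * P"
    and word: "n < 2 ^ b" "T * T < 2 ^ b" "T + 1 < 2 ^ b"
    and \<delta>: "36 * sqrt (real P * real T * ln n) \<le> \<delta> * T"
  shows "\<exists>A :: 'p expert_algorithm. streaming_algorithm A n (7 + k) b \<and>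
    (\<forall>(x :: nat \<Rightarrow> nat \<Rightarrow> 'p) (c :: nat \<Rightarrow> nat \<Rightarrow> real). (\<forall>t<T. \<forall>i<n. c t i \<in> {0..1}) \<longrightarrow>
      expected_regret_random_order A n T (\<lambda>t. (x t, c t)) \<le> \<delta>)"
proof (intro exI conjI allI impI)
  let ?step = "guarded (7 + k) b (\<lambda>m r. explore_turn n P (explore_read k T m r))"
  \<comment> \<open>The default \<open>0\<close> concerns memories that no run reaches:
    \<open>streaming_algorithm\<close> demands an expert below \<open>n\<close> from every
    memory.\<close>
  let ?pick = "\<lambda>m. return_pmf (if m ! 4 < n then m ! 4 else 0)"
  let ?A = "table_algorithm (explore_initial k) ?step ?pick :: 'p expert_algorithm"
  have "1 < (2::nat) ^ b" using word(1) n by linarith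
  then show "streaming_algorithm ?A n (7 + k) b"
    using n by (intro streaming_table_algorithm guarded_memories) (auto simp: memories_def explore_initial_def)
  fix x :: "nat \<Rightarrow> nat \<Rightarrow> 'p" and c :: "nat \<Rightarrow> nat \<Rightarrow> real"
  assume c: "\<forall>t<T. \<forall>i<n. c t i \<in> {0..1}"
  then interpret shuffled_exploration n P k T b c
    using assms by unfold_locales auto
  have T: "real T > 0" using P by linarith
  define B where "B = Min ((\<lambda>i. \<Sum>t<T. c t i) ` {..<n})"
  have best: "T * best \<le> B"
    unfolding B_def
  proof (rule Min.boundedI)
    fix a assume "a \<in> (\<lambda>i. \<Sum>t<T. c t i) ` {..<n}"
    then obtain i where i: "i < n" "a = (\<Sum>t<T. c t i)" by auto
    have "best \<le> mean i" unfolding best_def using i by (intro Min_le) auto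
    then show "T * best \<le> a" using T i by (simp add: field_simps)
  qed (use n in \<open>auto simp: lessThan_empty_iff\<close>)
  have "measure_pmf.expectation orders
      (\<lambda>xs. \<Sum>t<T. measure_pmf.expectation (?pick (table_after ?step (explore_initial k) n (\<lambda>t. c (xs ! t)) t)) (c (xs ! t)))
      \<le> expect (\<lambda>xs. \<Sum>t<T. incurred xs t)"
  proof (rule expect_mono)
    fix xs assume xs: "xs \<in> permutations_of_set {..<T}"
    interpret E: exploration n P k T b "\<lambda>t. c (xs ! t)" by (rule exploration[OF xs])
    have M: "table_after ?step (explore_initial k) n (\<lambda>t. c (xs ! t)) t = E.M t" for t
      by (simp add: E.M_def E.step_def)
    have "E.M t ! 4 < n" if "t < T" for t
      using E.state_ok_M[of t] that by (auto simp: E.state_ok_def E.good_leader_def)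
    then show "(\<Sum>t<T. measure_pmf.expectation (?pick (table_after ?step (explore_initial k) n (\<lambda>t. c (xs ! t)) t)) (c (xs ! t)))
        \<le> (\<Sum>t<T. incurred xs t)"
      unfolding M by (simp add: incurred_def)
  qed
  also have "\<dots> \<le> B + \<delta> * T"
    using expect_total_le best \<delta> by linarith
  finally have "measure_pmf.expectation orders
      (\<lambda>xs. \<Sum>t<T. measure_pmf.expectation (?pick (table_after ?step (explore_initial k) n (\<lambda>t. c (xs ! t)) t)) (c (xs ! t))) - B
      \<le> \<delta> * T" by linarith
  then show "expected_regret_random_order ?A n T (\<lambda>t. (x t, c t)) \<le> \<delta>"
    using T by (subst expected_regret_table_algorithm) (simp_all add: B_def divide_le_eq)
qed

lemma word_length:
  fixes n T :: nat
  assumes n: "n \<ge> 2" and T: "T \<ge> 1"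
  obtains b :: nat where "n < 2 ^ b" "T * T < 2 ^ b" "T + 1 < 2 ^ b" "real b \<le> 4 * log 2 (real n * real T)"
proof -
  \<comment> \<open>As \<open>n \<ge> 2\<close>, \<open>N\<close> is at least \<open>T + 1\<close>,
    so \<open>N ^ 2\<close> dominates all three quantities and about \<open>2 * log 2 N\<close> bits
    suffice.\<close>
  define N where "N = n * T"
  define b where "b = nat \<lceil>2 * log 2 N\<rceil> + 1"
  have N: "n \<le> N" "T + 1 \<le> N" "T \<le> N" "N \<ge> 2"
    using n T mult_le_mono1[of 2 n T] mult_le_mono2[of 1 T n] by (auto simp: N_def mult_2)
  have "log 2 (2::real) \<le> log 2 N" using N by (subst log_le_cancel_iff) auto
  then have log: "1 \<le> log 2 N" by simp
  have "real N ^ 2 = (2 powr log 2 N) ^ 2"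
    using N by simp
  also have "\<dots> = 2 powr (2 * log 2 N)"
    by (simp only: powr_power mult.commute) simp
  also have "\<dots> < 2 powr b"
    using log unfolding b_def by (intro powr_less_mono) linarith+
  also have "\<dots> = 2 ^ b" by (simp add: powr_realpow)
  finally have "real (N ^ 2) < real (2 ^ b)" by simp
  then have "N ^ 2 < 2 ^ b" by (simp only: of_nat_less_iff)
  moreover have "N * 1 \<le> N ^ 2" "T * T \<le> N ^ 2"
    unfolding power2_eq_square using N by (auto intro!: mult_le_mono)
  moreover have "real b \<le> 4 * log 2 (real n * real T)"
  proof -
    have "real b \<le> 2 * log 2 N + 2" using log unfolding b_def by linarith
    then show ?thesis using log by (simp add: N_def)
  qed
  ultimately show ?thesis using N by (intro that[of b]) linarith+
qed

theorem theorem4p4: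
  shows "\<exists>K>0. \<forall>(n::nat) (T::nat) (\<delta>::real).
    n \<ge> 1 \<longrightarrow> T \<ge> 1 \<longrightarrow> \<delta> > sqrt (16 * (ln (real n))\<^sup>2 / real T) \<longrightarrow>
    (\<exists>(A :: 'p expert_algorithm) (s::nat) (b::nat).
        streaming_algorithm A n s b \<and>
        real s \<le> K * max 1 (real n / (\<delta>\<^sup>2 * real T) * (ln (real n))\<^sup>2) \<and>
        real b \<le> K * log 2 (real n * real T) \<and>
        (\<forall>(x :: nat \<Rightarrow> nat \<Rightarrow> 'p) (c :: nat \<Rightarrow> nat \<Rightarrow> real).
           (\<forall>t<T. \<forall>i<n. c t i \<in> {0..1}) \<longrightarrow>
           expected_regret_random_order A n T (\<lambda>t. (x t, c t)) \<le> \<delta>))"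
proof (rule exI[of _ 5008], intro conjI allI impI)
  \<comment> \<open>The witness is \<open>5000 + 8\<close>: \<open>5000 * X\<close> bounds the
    counters, and \<open>8\<close> stands for the seven control words and the rounding in
    \<open>k = n div P + 1\<close>.\<close>
  fix n T :: nat and \<delta> :: real
  assume n: "n \<ge> 1" and T: "T \<ge> 1" and \<delta>: "\<delta> > sqrt (16 * (ln (real n))\<^sup>2 / real T)"
  define X where "X = real n / (\<delta>\<^sup>2 * real T) * (ln (real n))\<^sup>2"
  have "sqrt (16 * (ln (real n))\<^sup>2 / real T) \<ge> 0" by simp
  with \<delta> have \<delta>0: "\<delta> > 0" by linarith
  have nT: "1 \<le> real n * real T" using n T mult_mono[of 1 "real n" 1 "real T"] by simp
  let ?goal = "\<exists>(A :: 'p expert_algorithm) (s::nat) (b::nat).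
        streaming_algorithm A n s b \<and> real s \<le> 5008 * max 1 X \<and>
        real b \<le> 5008 * log 2 (real n * real T) \<and>
        (\<forall>(x :: nat \<Rightarrow> nat \<Rightarrow> 'p) (c :: nat \<Rightarrow> nat \<Rightarrow> real).
           (\<forall>t<T. \<forall>i<n. c t i \<in> {0..1}) \<longrightarrow>
           expected_regret_random_order A n T (\<lambda>t. (x t, c t)) \<le> \<delta>)"
  have ?goal
  proof (cases "n = 1 \<or> \<delta> \<ge> 1")
    case True
    from constant_algorithm[OF n T _ this, where 'p = 'p] \<delta>0 obtain A :: "'p expert_algorithm" where
      "streaming_algorithm A n 0 0"
      "\<forall>(x :: nat \<Rightarrow> nat \<Rightarrow> 'p) (c :: nat \<Rightarrow> nat \<Rightarrow> real). (\<forall>t<T. \<forall>i<n. c t i \<in> {0..1}) \<longrightarrow>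
           expected_regret_random_order A n T (\<lambda>t. (x t, c t)) \<le> \<delta>"
      by auto
    then show ?thesis
      using nT by (intro exI[of _ A] exI[of _ "0::nat"]) auto
  next
    case False
    then have n2: "n \<ge> 2" and \<delta>1: "\<delta> < 1" using n by auto
    define L where "L = ln (real n)"
    have "2/3 \<le> ln (2::real)" by (rule ln2_ge_two_thirds)
    also have "\<dots> \<le> L" using n2 by (simp add: L_def)
    finally have L: "2/3 \<le> L" .
    have T0: "real T > 0" using T by simp
    obtain b where b: "n < 2 ^ b" "T * T < 2 ^ b" "T + 1 < 2 ^ b" "real b \<le> 4 * log 2 (real n * real T)"
      using word_length[OF n2 T] .
    have "0 \<le> log 2 (real n * real T)" using nT by simp
    then have b': "real b \<le> 5008 * log 2 (real n * real T)" using b(4) by linarith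
    show ?thesis
    proof (cases "\<delta>\<^sup>2 * T \<le> 5000 * L\<^sup>2")
      case True
      \<comment> \<open>The hypothesis on \<delta> gives
        \<open>4 * L * sqrt T \<le> \<delta> * T\<close>; one half pays for the regret of Hedge, the
        other for the rounding error \<open>1\<close>.\<close>
      have "sqrt (2 * real T * ln n) + 1 \<le> \<delta> * T"
      proof -
        have sT: "sqrt T \<ge> 1" using T by simp
        have "2 * T * L \<le> (2 * L * sqrt T)\<^sup>2"
        proof -
          have "L * 1 \<le> L * (2 * L)" using L by (intro mult_left_mono) auto
          then have "T * (2 * L) \<le> T * (4 * L\<^sup>2)" by (intro mult_left_mono) (auto simp: power2_eq_square)
          then show ?thesis by (simp add: power_mult_distrib mult_ac)
        qed
        then have "sqrt (2 * T * L) \<le> 2 * L * sqrt T"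
          using L by (intro real_le_lsqrt) auto
        moreover have "1 \<le> 2 * L * sqrt T"
          using L sT mult_mono[of 1 "2 * L" 1 "sqrt T"] by simp
        moreover have "4 * L * sqrt T \<le> \<delta> * T"
        proof -
          have "sqrt (16 * L\<^sup>2 / T) * T = 4 * L * sqrt T"
          proof -
            have "sqrt (16 * L\<^sup>2 / T) * T = 4 * L * (T / sqrt T)"
              using L by (simp add: real_sqrt_divide real_sqrt_mult)
            then show ?thesis using T0 by (simp only: real_div_sqrt less_imp_le)
          qed
          moreover have "sqrt (16 * L\<^sup>2 / T) * T \<le> \<delta> * T"
            using \<delta> by (intro mult_right_mono) (auto simp: L_def)
          ultimately show ?thesis by simp
        qed
        ultimately show ?thesis by (simp add: L_def)
      qed
      from hedge_algorithm[OF n2 T b(1,2) this, where 'p = 'p] obtain A :: "'p expert_algorithm" where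
        A: "streaming_algorithm A n (1 + n) b"
        "\<forall>(x :: nat \<Rightarrow> nat \<Rightarrow> 'p) (c :: nat \<Rightarrow> nat \<Rightarrow> real). (\<forall>t<T. \<forall>i<n. c t i \<in> {0..1}) \<longrightarrow>
           expected_regret_random_order A n T (\<lambda>t. (x t, c t)) \<le> \<delta>"
        by auto
      have "real n * (\<delta>\<^sup>2 * T) \<le> real n * (5000 * L\<^sup>2)"
        using True by (intro mult_left_mono) auto
      then have "real n \<le> 5000 * X"
        using \<delta>0 T0 by (simp add: X_def L_def field_simps)
      then have "real (1 + n) \<le> 5008 * max 1 X" by simp
      with A b' show ?thesis by blast
    next
      case False
      \<comment> \<open>The desired number of pools before rounding. Since \<open>y > 1\<close>,
        rounding up at most doubles it.\<close>
      define y where "y = \<delta>\<^sup>2 * T / (5000 * L\<^sup>2)"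
      have L2: "5000 * L\<^sup>2 \<ge> 1" using mult_mono[of "2/3" L "2/3" L] L by (simp add: power2_eq_square)
      then have "0 < 5000 * L\<^sup>2" by linarith
      then have y1: "y > 1" using False by (simp only: y_def less_divide_eq_1_pos not_le)
      define P where "P = nat \<lceil>y\<rceil>"
      define k where "k = n div P + 1"
      have P: "P > 0" "y \<le> P" "P \<le> 2 * y" using y1 unfolding P_def by linarith+
      \<comment> \<open>This rests on \<open>\<delta> < 1\<close>, the reason why larger \<delta>
        was treated separately.\<close>
      have "y \<le> T"
      proof -
        have "\<delta>\<^sup>2 * T \<le> 1 * real T" using \<delta>0 \<delta>1 by (intro mult_right_mono power_le_one) auto
        also have "\<dots> \<le> (5000 * L\<^sup>2) * real T" using L2 by (intro mult_right_mono) auto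
        finally show ?thesis using L2 by (simp add: y_def divide_le_eq mult.commute)
      qed
      then have PT: "P \<le> T" unfolding P_def by linarith
      have pools: "n \<le> k * P"
        using div_mult_mod_eq[of n P] mod_less_divisor[OF P(1), of n]
        unfolding k_def distrib_right mult_1 by linarith
      \<comment> \<open>Squaring \<open>36\<close> and the factor \<open>2\<close> from
        \<open>P \<le> 2 * y\<close> give \<open>2592\<close>, which is at most
        \<open>5000 * L\<close> because \<open>L \<ge> 2/3\<close>; this fixes the constant in
        \<open>y\<close>.\<close>
      have "36 * sqrt (real P * real T * ln n) \<le> \<delta> * T"
      proof -
        have "1296 * (real P * T * L) \<le> 1296 * (2 * y * T * L)"
          using P L by (intro mult_left_mono mult_right_mono) auto
        also have "\<dots> = 2592 / (5000 * L) * (\<delta> * T)\<^sup>2"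
          using L by (simp add: y_def power2_eq_square)
        also have "\<dots> \<le> 1 * (\<delta> * T)\<^sup>2"
          using L by (intro mult_right_mono) (auto simp: divide_le_eq)
        finally have "sqrt (36\<^sup>2 * (real P * T * L)) \<le> sqrt ((\<delta> * T)\<^sup>2)"
          by (intro real_sqrt_le_mono) simp
        then show ?thesis using \<delta>0 by (simp add: real_sqrt_mult L_def)
      qed
      from exploration_algorithm[OF n2 P(1) PT _ pools b(1-3) this, where 'p = 'p] obtain A :: "'p expert_algorithm" where
        A: "streaming_algorithm A n (7 + k) b"
        "\<forall>(x :: nat \<Rightarrow> nat \<Rightarrow> 'p) (c :: nat \<Rightarrow> nat \<Rightarrow> real). (\<forall>t<T. \<forall>i<n. c t i \<in> {0..1}) \<longrightarrow>
           expected_regret_random_order A n T (\<lambda>t. (x t, c t)) \<le> \<delta>"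
        by (auto simp: k_def)
      have "real (n div P) \<le> real n / P" by (rule of_nat_div_le_of_nat)
      also have "\<dots> \<le> real n / y" using P y1 by (intro divide_left_mono) auto
      also have "\<dots> = 5000 * X" by (simp add: y_def X_def L_def)
      finally have "real (7 + k) \<le> 5008 * max 1 X" by (simp add: k_def)
      with A b' show ?thesis by blast
    qed
  qed
  then show "\<exists>(A :: 'p expert_algorithm) (s::nat) (b::nat).
        streaming_algorithm A n s b \<and>
        real s \<le> 5008 * max 1 (real n / (\<delta>\<^sup>2 * real T) * (ln (real n))\<^sup>2) \<and>
        real b \<le> 5008 * log 2 (real n * real T) \<and>
        (\<forall>(x :: nat \<Rightarrow> nat \<Rightarrow> 'p) (c :: nat \<Rightarrow> nat \<Rightarrow> real).
           (\<forall>t<T. \<forall>i<n. c t i \<in> {0..1}) \<longrightarrow>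
           expected_regret_random_order A n T (\<lambda>t. (x t, c t)) \<le> \<delta>)"
    by (simp only: X_def)
qed simp

end
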